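(* Let $G$ be a finitely presented group with finite presentation $\mathcal{P}=\langle \mathcal{S}\mid\mathcal{W}\rangle$ whose Dehn function $f_G$ is polynomial (bounded above by a polynomial), and let $L^{st}_G$ be the standard word-length function on $G$ associated with the generating set $\mathcal{S}$. Then the map $$\alpha_2(G,L^{st}_G): H_2(G;\mathbb{Q})\to (H^2(G;\mathbb{Q}))^*\to (PH^2(G;\mathbb{Q}))^*$$ is an isomorphism.
   Context: Let $F$ be the free group on $\mathcal{S}$ with standard word-length $L_F$ (each generator has length $1$), and $F'\subset F$ the normal closure of $\mathcal{W}$, so $G=F/F'$. $L^{st}_G(g)=\min\{L_F(w): w\mapsto g\}$. For $y\in F'$, $\mathrm{Area}_{\mathcal{P}}(y)$ is the minimal $n$ such that $y=\bar w_1^{x_1}\cdots \bar w_n^{x_n}$ with $w_i^{\pm1}\in\mathcal{W}$, $x_i\in F$, $\bar w^x=x\bar w x^{-1}$. The Dehn function $f_{\mathcal P}:\mathbb{N}\to\mathbb{N}$ is the minimal function with $\mathrm{Area}_{\mathcal P}(y)\le f_{\mathcal P}(n)$ for all $y\in F'$ with $L_F(y)\le n$. p-bounded cohomology: for a group $G$ with word-length function $L$, $PH^*(G;\mathbb{Q})$ is the cohomology of the subcomplex of the (non-homogeneous) bar cochain complex $\mathrm{Hom}_G(C_*(EG;\mathbb{Q}),\mathbb{Q})$ consisting of cochains of polynomial growth, i.e. $G$-equivariant linear $\phi$ on $C_n(EG;\mathbb Q)=\mathbb{Q}[G][\{(1,g_1,\dots,g_n)\}]$ such that $|\phi(1,g_1,\dots,g_n)|\le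 C(1+\sum_i L(g_i))^k$ for some constants $C,k$. The inclusion of cochain complexes induces $PH^*(G;\mathbb Q)\to H^*(G;\mathbb Q)$; its dual composed with the universal-coefficient map $H_*(G;\mathbb Q)\to (H^*(G;\mathbb Q))^*$ is $\alpha_*(G,L)$. *)

theory Defs
  imports Complex_Main "HOL-Algebra.Group"
begin

text \<open>A letter (s, True) stands for the generator s, (s, False) for its inverse.
  Elements of the free group F on S are represented by words up to free equivalence.\<close>

type_synonym 'a word = "('a \<times> bool) list"

definition words :: "'a set \<Rightarrow> 'a word set" where
  "words S = {w. \<forall>x\<in>set w. fst x \<in> S}"

definition inv_word :: "'a word \<Rightarrow> 'a word" where
  "inv_word w = rev (map (\<lambda>(s, b). (s, \<not> b)) w)"

definition cancel1 :: "'a word \<Rightarrow> 'a word \<Rightarrow> bool" where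
  "cancel1 u v \<longleftrightarrow> (\<exists>xs ys s b. u = xs @ [(s, b), (s, \<not> b)] @ ys \<and> v = xs @ ys)"

definition free_eq :: "'a word \<Rightarrow> 'a word \<Rightarrow> bool" where
  "free_eq = equivclp cancel1"

definition conj_prod :: "('a word \<times> 'a word \<times> bool) list \<Rightarrow> 'a word" where
  "conj_prod cs = concat (map (\<lambda>(x, r, e). x @ (if e then r else inv_word r) @ inv_word x) cs)"

definition conj_decomp :: "'a set \<Rightarrow> 'a word set \<Rightarrow> 'a word \<Rightarrow> ('a word \<times> 'a word \<times> bool) list \<Rightarrow> bool" where
  "conj_decomp S W w cs \<longleftrightarrow>
     (\<forall>(x, r, e)\<in>set cs. x \<in> words S \<and> r \<in> W) \<and> free_eq w (conj_prod cs)"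

definition in_normal_closure :: "'a set \<Rightarrow> 'a word set \<Rightarrow> 'a word \<Rightarrow> bool" where
  "in_normal_closure S W w \<longleftrightarrow> (\<exists>cs. conj_decomp S W w cs)"

definition area :: "'a set \<Rightarrow> 'a word set \<Rightarrow> 'a word \<Rightarrow> nat" where
  "area S W w = (LEAST n. \<exists>cs. length cs = n \<and> conj_decomp S W w cs)"

text \<open>Dehn function: maximal area of a null-homotopic word of length at most n
  (taking all words of length \<le> n gives the same supremum as taking reduced words,
  i.e. free group elements y with L_F(y) \<le> n).\<close>
definition dehn_function :: "'a set \<Rightarrow> 'a word set \<Rightarrow> nat \<Rightarrow> nat" where
  "dehn_function S W n =
     Sup {area S W w | w. w \<in> words S \<and> length w \<le> n \<and> in_normal_closure S W w}"

definition eval_word :: "('g, 'b) monoid_scheme \<Rightarrow> ('a \<Rightarrow> 'g) \<Rightarrow> 'a word \<Rightarrow> 'g" where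
  "eval_word G gen w =
     foldr (\<lambda>(s, b) acc. (if b then gen s else inv\<^bsub>G\<^esub> (gen s)) \<otimes>\<^bsub>G\<^esub> acc) w \<one>\<^bsub>G\<^esub>"

definition finite_presentation ::
  "('g, 'b) monoid_scheme \<Rightarrow> ('a \<Rightarrow> 'g) \<Rightarrow> 'a set \<Rightarrow> 'a word set \<Rightarrow> bool" where
  "finite_presentation G gen S W \<longleftrightarrow>
     group G \<and> finite S \<and> finite W \<and> W \<subseteq> words S \<and> gen \<in> S \<rightarrow> carrier G \<and>
     carrier G = eval_word G gen ` words S \<and>
     (\<forall>w\<in>words S. eval_word G gen w = \<one>\<^bsub>G\<^esub> \<longleftrightarrow> in_normal_closure S W w)"

definition polynomial_dehn :: "'a set \<Rightarrow> 'a word set \<Rightarrow> bool" where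
  "polynomial_dehn S W \<longleftrightarrow>
     (\<exists>C::real. \<exists>k::nat. \<forall>n. real (dehn_function S W n) \<le> C * (1 + real n) ^ k)"

definition std_length :: "('g, 'b) monoid_scheme \<Rightarrow> ('a \<Rightarrow> 'g) \<Rightarrow> 'a set \<Rightarrow> 'g \<Rightarrow> nat" where
  "std_length G gen S g = (LEAST n. \<exists>w\<in>words S. length w = n \<and> eval_word G gen w = g)"

definition face :: "('g, 'b) monoid_scheme \<Rightarrow> 'g list \<Rightarrow> nat \<Rightarrow> 'g list" where
  "face G gs i =
     (if i = 0 then tl gs
      else if i = length gs then butlast gs
      else take (i - 1) gs @ [gs ! (i - 1) \<otimes>\<^bsub>G\<^esub> gs ! i] @ drop (i + 1) gs)"

definition chains :: "('g, 'b) monoid_scheme \<Rightarrow> nat \<Rightarrow> ('g list \<Rightarrow> rat) set" where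
  "chains G n = {c. finite {x. c x \<noteq> 0} \<and>
      (\<forall>x. c x \<noteq> 0 \<longrightarrow> x \<in> lists (carrier G) \<and> length x = n)}"

definition bd :: "('g, 'b) monoid_scheme \<Rightarrow> ('g list \<Rightarrow> rat) \<Rightarrow> ('g list \<Rightarrow> rat)" where
  "bd G c = (\<lambda>y. \<Sum>x\<in>{x. c x \<noteq> 0}. \<Sum>i\<in>{0..length x}.
                  if face G x i = y then (-1) ^ i * c x else 0)"

definition cycles :: "('g, 'b) monoid_scheme \<Rightarrow> nat \<Rightarrow> ('g list \<Rightarrow> rat) set" where
  "cycles G n = {c \<in> chains G n. bd G c = (\<lambda>_. 0)}"

definition boundaries :: "('g, 'b) monoid_scheme \<Rightarrow> nat \<Rightarrow> ('g list \<Rightarrow> rat) set" where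
  "boundaries G n = bd G ` chains G (Suc n)"

definition homology :: "('g, 'b) monoid_scheme \<Rightarrow> nat \<Rightarrow> ('g list \<Rightarrow> rat) set set" where
  "homology G n = cycles G n //
     {(c, d). c \<in> cycles G n \<and> d \<in> cycles G n \<and> (\<lambda>x. c x - d x) \<in> boundaries G n}"

definition cochains :: "('g, 'b) monoid_scheme \<Rightarrow> nat \<Rightarrow> ('g list \<Rightarrow> rat) set" where
  "cochains G n = {\<phi>. \<forall>x. \<phi> x \<noteq> 0 \<longrightarrow> x \<in> lists (carrier G) \<and> length x = n}"

definition cob :: "('g, 'b) monoid_scheme \<Rightarrow> nat \<Rightarrow> ('g list \<Rightarrow> rat) \<Rightarrow> ('g list \<Rightarrow> rat)" where
  "cob G n \<phi> = (\<lambda>gs. if gs \<in> lists (carrier G) \<and> length gs = Suc n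
                      then \<Sum>i\<in>{0..Suc n}. (-1) ^ i * \<phi> (face G gs i) else 0)"

definition poly_growth :: "('g, 'b) monoid_scheme \<Rightarrow> ('g \<Rightarrow> nat) \<Rightarrow> ('g list \<Rightarrow> rat) \<Rightarrow> bool" where
  "poly_growth G L \<phi> \<longleftrightarrow>
     (\<exists>C::rat. \<exists>k::nat. \<forall>gs\<in>lists (carrier G).
        \<bar>\<phi> gs\<bar> \<le> C * (1 + of_nat (sum_list (map L gs))) ^ k)"

definition pcochains :: "('g, 'b) monoid_scheme \<Rightarrow> ('g \<Rightarrow> nat) \<Rightarrow> nat \<Rightarrow> ('g list \<Rightarrow> rat) set" where
  "pcochains G L n = {\<phi> \<in> cochains G n. poly_growth G L \<phi>}"

definition pcocycles :: "('g, 'b) monoid_scheme \<Rightarrow> ('g \<Rightarrow> nat) \<Rightarrow> nat \<Rightarrow> ('g list \<Rightarrow> rat) set" where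
  "pcocycles G L n = {\<phi> \<in> pcochains G L n. cob G n \<phi> = (\<lambda>_. 0)}"

definition pcoboundaries :: "('g, 'b) monoid_scheme \<Rightarrow> ('g \<Rightarrow> nat) \<Rightarrow> nat \<Rightarrow> ('g list \<Rightarrow> rat) set" where
  "pcoboundaries G L n = (case n of 0 \<Rightarrow> {\<lambda>_. 0} | Suc m \<Rightarrow> cob G m ` pcochains G L m)"

text \<open>(PH^n(G;Q))^*, with PH^n = PZ^n / PB^n, represented as the Q-linear functionals
  on PZ^n vanishing on PB^n (set to 0 outside PZ^n, for extensionality).\<close>
definition pcohomology_dual ::
  "('g, 'b) monoid_scheme \<Rightarrow> ('g \<Rightarrow> nat) \<Rightarrow> nat \<Rightarrow> (('g list \<Rightarrow> rat) \<Rightarrow> rat) set" where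
  "pcohomology_dual G L n = {\<Lambda>.
     (\<forall>\<phi>\<in>pcocycles G L n. \<forall>\<psi>\<in>pcocycles G L n. \<Lambda> (\<lambda>x. \<phi> x + \<psi> x) = \<Lambda> \<phi> + \<Lambda> \<psi>) \<and>
     (\<forall>a \<phi>. \<phi> \<in> pcocycles G L n \<longrightarrow> \<Lambda> (\<lambda>x. a * \<phi> x) = a * \<Lambda> \<phi>) \<and>
     (\<forall>\<phi>\<in>pcoboundaries G L n. \<Lambda> \<phi> = 0) \<and>
     (\<forall>\<phi>. \<phi> \<notin> pcocycles G L n \<longrightarrow> \<Lambda> \<phi> = 0)}"

definition pairing :: "('g list \<Rightarrow> rat) \<Rightarrow> ('g list \<Rightarrow> rat) \<Rightarrow> rat" where
  "pairing \<phi> c = (\<Sum>x\<in>{x. c x \<noteq> 0}. c x * \<phi> x)"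

definition alpha :: "('g, 'b) monoid_scheme \<Rightarrow> ('g \<Rightarrow> nat) \<Rightarrow> nat \<Rightarrow>
    ('g list \<Rightarrow> rat) set \<Rightarrow> (('g list \<Rightarrow> rat) \<Rightarrow> rat)" where
  "alpha G L n X = (\<lambda>\<phi>. if \<phi> \<in> pcocycles G L n then pairing \<phi> (SOME c. c \<in> X) else 0)"

end

theory Submission
  imports Defs "HOL-Library.Function_Algebras"
begin

text \<open>A rational 2-cocycle \<open>\<phi>\<close> on G defines a central extension of G by the rationals, and evaluating words in
  it assigns a central value to every null-homotopic word. Choosing a geodesic word for each
  group element, \<open>\<phi>\<close> is cohomologous to the cocycle whose value at (g, h) is the value of the word
  \<open>nf g \<sqdot> nf h \<sqdot> (nf (gh))\<^sup>-\<^sup>1\<close>, which is a signed sum of relator values with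
  as many terms as the area of that word. Hence a polynomial Dehn function makes every class
  p-bounded, and a cycle annihilated by all p-bounded cocycles is annihilated by all cocycles, so it
  is a boundary. Conversely, the class of a p-bounded cocycle is determined by
  its finitely many relator values, each of which is the pairing with a fixed chain; so every functional on
  p-bounded cohomology is the pairing with a chain, and this chain is a cycle because
  the functional kills the coboundaries of point masses.\<close>

section \<open>Linear algebra over the rationals\<close>

text \<open>A basis of \<open>U\<close> stays independent after adjoining \<open>c\<close>, so the
  values 0 on the basis and 1 at \<open>c\<close> extend to a linear functional. With the boundaries
  as \<open>U\<close>, it detects a cycle that does not bound.\<close>

lemma separating_functional:
  fixes U :: "('x \<Rightarrow> rat) set" and c :: "'x \<Rightarrow> rat"
  assumes zero: "(\<lambda>_. 0) \<in> U"
    and add: "\<And>u v. u \<in> U \<Longrightarrow> v \<in> U \<Longrightarrow> (\<lambda>x. u x + v x) \<in> U"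
    and scale: "\<And>a u. u \<in> U \<Longrightarrow> (\<lambda>x. a * u x) \<in> U"
    and c: "c \<notin> U"
  shows "\<exists>F :: ('x \<Rightarrow> rat) \<Rightarrow> rat.
    (\<forall>u v. F (\<lambda>x. u x + v x) = F u + F v) \<and> (\<forall>a u. F (\<lambda>x. a * u x) = a * F u) \<and>
    (\<forall>u\<in>U. F u = 0) \<and> F c = 1"
proof -
  interpret V: vector_space "\<lambda>(a::rat) (f::'x \<Rightarrow> rat) x. a * f x"
    by unfold_locales (auto simp: fun_eq_iff algebra_simps)
  interpret Q: vector_space "(*) :: rat \<Rightarrow> rat \<Rightarrow> rat"
    by unfold_locales (auto simp: algebra_simps)
  interpret P: vector_space_pair "\<lambda>(a::rat) (f::'x \<Rightarrow> rat) x. a * f x" "(*) :: rat \<Rightarrow> rat \<Rightarrow> rat" ..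
  have U: "V.subspace U"
    unfolding V.subspace_def zero_fun_def plus_fun_def using assms by blast
  obtain B where B: "B \<subseteq> U" "\<not> V.dependent B" "U \<subseteq> V.span B" "card B = V.dim U"
    by (rule V.basis_exists)
  have "c \<notin> V.span B"
    using c V.span_minimal[OF B(1) U] by (rule contra_subsetD[rotated])
  then have "\<not> V.dependent (insert c B)"
    using B(2) by (rule V.independent_insertI)
  then obtain F where F: "Vector_Spaces.linear (\<lambda>(a::rat) (f::'x \<Rightarrow> rat) x. a * f x) (*) F"
      and FB: "\<forall>x\<in>insert c B. F x = (if x = c then 1 else 0)"
    using P.linear_independent_extend[of "insert c B" "\<lambda>x. if x = c then 1 else 0"] by metis
  interpret F: Vector_Spaces.linear "\<lambda>(a::rat) (f::'x \<Rightarrow> rat) x. a * f x" "(*)" F by (fact F)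
  have "F u = 0" if "u \<in> U" for u
  proof (rule P.linear_eq_0_on_span[OF F, of B])
    show "F b = 0" if "b \<in> B" for b using FB that B(1) c by auto
  qed (fact subsetD[OF B(3) that])
  moreover have "F (\<lambda>x. u x + v x) = F u + F v" for u v
    using F.add[of u v] by (simp add: plus_fun_def)
  ultimately show ?thesis using FB F.scale by (intro exI[of _ F]) simp
qed

text \<open>A functional vanishing on a common kernel of finitely many functionals is a combination
  of them, by induction on the index set. Linearity is asked for on \<open>Z\<close> alone, since
  elements of the dual are linear only on p-bounded cocycles.\<close>

lemma functional_combination:
  fixes Z :: "('x \<Rightarrow> rat) set" and T :: "'i \<Rightarrow> ('x \<Rightarrow> rat) \<Rightarrow> rat" and \<Lambda> :: "('x \<Rightarrow> rat) \<Rightarrow> rat"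
  assumes "finite I"
    and "\<And>u v. u \<in> Z \<Longrightarrow> v \<in> Z \<Longrightarrow> (\<lambda>x. u x + v x) \<in> Z"
    and "\<And>a u. u \<in> Z \<Longrightarrow> (\<lambda>x. a * u x) \<in> Z"
    and "\<And>u v. u \<in> Z \<Longrightarrow> v \<in> Z \<Longrightarrow> \<Lambda> (\<lambda>x. u x + v x) = \<Lambda> u + \<Lambda> v"
    and "\<And>a u. u \<in> Z \<Longrightarrow> \<Lambda> (\<lambda>x. a * u x) = a * \<Lambda> u"
    and "\<And>i u v. i \<in> I \<Longrightarrow> u \<in> Z \<Longrightarrow> v \<in> Z \<Longrightarrow> T i (\<lambda>x. u x + v x) = T i u + T i v"
    and "\<And>i a u. i \<in> I \<Longrightarrow> u \<in> Z \<Longrightarrow> T i (\<lambda>x. a * u x) = a * T i u"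
    and "\<And>u. u \<in> Z \<Longrightarrow> (\<And>i. i \<in> I \<Longrightarrow> T i u = 0) \<Longrightarrow> \<Lambda> u = 0"
  shows "\<exists>l. \<forall>u\<in>Z. \<Lambda> u = (\<Sum>i\<in>I. l i * T i u)"
  using assms
proof (induction I arbitrary: Z rule: finite_induct)
  case empty
  then show ?case by simp
next
  case (insert r I)
  note add = insert.prems(1) and scale = insert.prems(2)
    and \<Lambda>add = insert.prems(3) and \<Lambda>scale = insert.prems(4)
    and Tadd = insert.prems(5) and Tscale = insert.prems(6)
  \<comment> \<open>The induction hypothesis is used for the kernel of \<open>T r\<close> in
    \<open>Z\<close>; hence \<open>Z\<close> varies in the induction.\<close>
  have "\<exists>l. \<forall>u\<in>{u\<in>Z. T r u = 0}. \<Lambda> u = (\<Sum>i\<in>I. l i * T i u)"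
  proof (rule insert.IH)
    fix u assume "u \<in> {u \<in> Z. T r u = 0}" "\<And>i. i \<in> I \<Longrightarrow> T i u = 0"
    then show "\<Lambda> u = 0" using insert.prems(7)[of u] by blast
  qed (simp_all add: add scale \<Lambda>add \<Lambda>scale Tadd Tscale)
  then obtain l where l: "\<Lambda> u = (\<Sum>i\<in>I. l i * T i u)" if "u \<in> Z" "T r u = 0" for u
    by blast
  show ?case
  proof (cases "\<forall>u\<in>Z. T r u = 0")
    case True
    then have "\<forall>u\<in>Z. \<Lambda> u = (\<Sum>i\<in>insert r I. l i * T i u)"
      using l insert.hyps by simp
    then show ?thesis by blast
  next
    case False
    then obtain v where v: "v \<in> Z" "T r v \<noteq> 0" by blast
    \<comment> \<open>This coefficient makes the formula exact at \<open>v\<close>.\<close>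
    define m where "m = (\<Lambda> v - (\<Sum>i\<in>I. l i * T i v)) / T r v"
    have "\<Lambda> u = (\<Sum>i\<in>insert r I. (l(r := m)) i * T i u)" if u: "u \<in> Z" for u
    proof -
      \<comment> \<open>With this factor \<open>u + a * v\<close> lies in the kernel of
        \<open>T r\<close>, where the formula for \<open>l\<close> applies.\<close>
      define a where "a = - (T r u / T r v)"
      have av: "(\<lambda>x. a * v x) \<in> Z" using scale v by blast
      have "T r (\<lambda>x. u x + a * v x) = 0"
        using Tadd[OF _ u av] Tscale[of r v a] v by (simp add: a_def)
      then have "\<Lambda> (\<lambda>x. u x + a * v x) = (\<Sum>i\<in>I. l i * T i (\<lambda>x. u x + a * v x))"
        using l add[OF u av] by blast
      moreover have "\<Lambda> (\<lambda>x. u x + a * v x) = \<Lambda> u + a * \<Lambda> v"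
        using \<Lambda>add[OF u av] \<Lambda>scale[of v a] v by simp
      moreover have "(\<Sum>i\<in>I. l i * T i (\<lambda>x. u x + a * v x)) = (\<Sum>i\<in>I. l i * T i u + a * (l i * T i v))"
        by (rule sum.cong) (use Tadd[OF _ u av] Tscale[of _ v a] v in \<open>simp_all add: algebra_simps\<close>)
      ultimately have "\<Lambda> u = (\<Sum>i\<in>I. l i * T i u) - a * (\<Lambda> v - (\<Sum>i\<in>I. l i * T i v))"
        by (simp add: sum.distrib flip: sum_distrib_left) (simp add: algebra_simps)
      also have "- a * (\<Lambda> v - (\<Sum>i\<in>I. l i * T i v)) = m * T r u"
        by (simp add: a_def m_def)
      then have "(\<Sum>i\<in>I. l i * T i u) - a * (\<Lambda> v - (\<Sum>i\<in>I. l i * T i v)) = m * T r u + (\<Sum>i\<in>I. l i * T i u)"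
        by simp
      also have "\<dots> = (\<Sum>i\<in>insert r I. (l(r := m)) i * T i u)"
      proof -
        have "(\<Sum>i\<in>I. (l(r := m)) i * T i u) = (\<Sum>i\<in>I. l i * T i u)"
          by (rule sum.cong) (use insert.hyps in auto)
        then show ?thesis using insert.hyps by simp
      qed
      finally show ?thesis .
    qed
    then show ?thesis by blast
  qed
qed

section \<open>Evaluation of words\<close>

lemma words_append [simp]: "u @ v \<in> words S \<longleftrightarrow> u \<in> words S \<and> v \<in> words S"
  by (auto simp: words_def)

lemma words_Nil [simp]: "[] \<in> words S"
  by (simp add: words_def)

lemma words_Cons [simp]: "x # w \<in> words S \<longleftrightarrow> fst x \<in> S \<and> w \<in> words S"
  by (auto simp: words_def)

lemma words_inv_word [simp]: "inv_word w \<in> words S \<longleftrightarrow> w \<in> words S"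
  by (force simp: words_def inv_word_def)

lemma length_inv_word [simp]: "length (inv_word w) = length w"
  by (simp add: inv_word_def)

lemma eval_word_Nil [simp]: "eval_word G gen [] = \<one>\<^bsub>G\<^esub>"
  by (simp add: eval_word_def)

lemma eval_word_Cons:
  "eval_word G gen ((s, b) # w) = (if b then gen s else inv\<^bsub>G\<^esub> (gen s)) \<otimes>\<^bsub>G\<^esub> eval_word G gen w"
  by (simp add: eval_word_def)

lemma eval_word_cong:
  assumes "\<And>s. s \<in> S \<Longrightarrow> gen s = gen' s" "w \<in> words S"
  shows "eval_word G gen w = eval_word G gen' w"
  using assms(2) by (induction w) (auto simp: eval_word_Cons assms(1))

context group
begin

lemma eval_word_closed [intro]:
  assumes "gen \<in> S \<rightarrow> carrier G" "w \<in> words S"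
  shows "eval_word G gen w \<in> carrier G"
  using assms(2)
proof (induction w)
  case (Cons x w)
  then have "gen (fst x) \<in> carrier G" using assms(1) by auto
  with Cons show ?case by (cases x) (auto simp: eval_word_Cons)
qed simp

lemma eval_word_append:
  assumes "gen \<in> S \<rightarrow> carrier G" "u \<in> words S" "v \<in> words S"
  shows "eval_word G gen (u @ v) = eval_word G gen u \<otimes> eval_word G gen v"
  using assms(2)
proof (induction u)
  case Nil
  then show ?case using eval_word_closed[OF assms(1,3)] by simp
next
  case (Cons x u)
  have "gen (fst x) \<in> carrier G" "eval_word G gen u \<in> carrier G" "eval_word G gen v \<in> carrier G"
    using assms Cons.prems by auto
  with Cons show ?case by (cases x) (auto simp: eval_word_Cons m_assoc)
qed

lemma eval_word_inv_word:
  assumes "gen \<in> S \<rightarrow> carrier G" "w \<in> words S"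
  shows "eval_word G gen (inv_word w) = inv (eval_word G gen w)"
  using assms(2)
proof (induction w)
  case Nil
  then show ?case by (simp add: inv_word_def)
next
  case (Cons x w)
  obtain s b where x: "x = (s, b)" by fastforce
  have s: "s \<in> S" "gen s \<in> carrier G" and w: "w \<in> words S" "eval_word G gen w \<in> carrier G"
    using assms(1) Cons.prems x by auto
  have "inv_word (x # w) = inv_word w @ [(s, \<not> b)]"
    by (simp add: inv_word_def x)
  then have "eval_word G gen (inv_word (x # w)) =
      inv (eval_word G gen w) \<otimes> eval_word G gen [(s, \<not> b)]"
    using eval_word_append[OF assms(1), of "inv_word w" "[(s, \<not> b)]"] Cons.IH s w by simp
  then show ?case using s w by (auto simp: x eval_word_Cons inv_mult_group)
qed

text \<open>A free equivalence between words over S may pass through words with letters outside S,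
  so the generator map is first extended by 1.\<close>

lemma eval_word_free_eq:
  assumes "free_eq u v" "gen \<in> S \<rightarrow> carrier G" "u \<in> words S" "v \<in> words S"
  shows "eval_word G gen u = eval_word G gen v"
proof -
  define gen' where "gen' s = (if s \<in> S then gen s else \<one>)" for s
  have gen': "gen' \<in> UNIV \<rightarrow> carrier G" using assms(2) by (auto simp: gen'_def)
  have all: "w \<in> words UNIV" for w :: "'c word" by (simp add: words_def)
  have step: "eval_word G gen' p = eval_word G gen' q" if pq1: "cancel1 p q" for p q
  proof -
    obtain xs ys s b where pq: "p = xs @ [(s, b), (s, \<not> b)] @ ys" "q = xs @ ys"
      using pq1 unfolding cancel1_def by blast
    have "gen' s \<in> carrier G" using gen' by blast
    then have "eval_word G gen' [(s, b), (s, \<not> b)] = \<one>"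
      by (simp add: eval_word_Cons)
    then show ?thesis unfolding pq
      by (simp only: eval_word_append[OF gen' all all] l_one[OF eval_word_closed[OF gen' all]])
  qed
  have "eval_word G gen' u = eval_word G gen' v"
    using assms(1) unfolding free_eq_def
    by (induction rule: equivclp_induct) (use step in auto)
  moreover have "eval_word G gen w = eval_word G gen' w" if "w \<in> words S" for w
    by (rule eval_word_cong[OF _ that]) (simp add: gen'_def)
  ultimately show ?thesis using assms(3,4) by simp
qed

end

section \<open>Chains, cochains and their pairing\<close>

lemma chainsD: "c \<in> chains G n \<Longrightarrow> finite {x. c x \<noteq> 0}"
  "c \<in> chains G n \<Longrightarrow> c x \<noteq> 0 \<Longrightarrow> x \<in> lists (carrier G)"
  "c \<in> chains G n \<Longrightarrow> c x \<noteq> 0 \<Longrightarrow> length x = n"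
  by (auto simp: chains_def)

lemma chains_zero: "(\<lambda>_. 0) \<in> chains G n"
  by (simp add: chains_def)

lemma chains_add:
  assumes "c \<in> chains G n" "d \<in> chains G n"
  shows "(\<lambda>x. c x + d x) \<in> chains G n"
proof -
  have "finite {x. c x + d x \<noteq> 0}"
    by (rule finite_subset[of _ "{x. c x \<noteq> 0} \<union> {x. d x \<noteq> 0}"]) (use assms chainsD in auto)
  moreover have "c x \<noteq> 0 \<or> d x \<noteq> 0" if "c x + d x \<noteq> 0" for x
    using that by auto
  ultimately show ?thesis
    using chainsD(2,3)[OF assms(1)] chainsD(2,3)[OF assms(2)] unfolding chains_def by blast
qed

lemma chains_scale: "c \<in> chains G n \<Longrightarrow> (\<lambda>x. a * c x) \<in> chains G n"
  by (auto simp: chains_def elim: finite_subset[rotated])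

lemma chains_diff: "c \<in> chains G n \<Longrightarrow> d \<in> chains G n \<Longrightarrow> (\<lambda>x. c x - d x) \<in> chains G n"
  using chains_add[of c G n "\<lambda>x. -1 * d x"] chains_scale[of d G n "-1"] by simp

lemma chains_single:
  "y \<in> lists (carrier G) \<Longrightarrow> length y = n \<Longrightarrow> (\<lambda>x. if x = y then 1 else 0) \<in> chains G n"
  by (simp add: chains_def)

section \<open>Bilinearity of the pairing\<close>

lemma pairing_eq_sum:
  assumes "finite A" "{x. c x \<noteq> 0} \<subseteq> A"
  shows "pairing \<phi> c = (\<Sum>x\<in>A. c x * \<phi> x)"
  unfolding pairing_def by (rule sum.mono_neutral_left) (use assms in auto)

lemma pairing_add_right:
  assumes "c \<in> chains G n" "d \<in> chains G n"
  shows "pairing \<phi> (\<lambda>x. c x + d x) = pairing \<phi> c + pairing \<phi> d"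
proof -
  let ?A = "{x. c x \<noteq> 0} \<union> {x. d x \<noteq> 0}"
  have A: "finite ?A" using assms chainsD(1) by blast
  show ?thesis
    by (subst (1 2 3) pairing_eq_sum[OF A]) (auto simp: sum.distrib algebra_simps)
qed

lemma pairing_scale_right:
  assumes "c \<in> chains G n"
  shows "pairing \<phi> (\<lambda>x. a * c x) = a * pairing \<phi> c"
  by (subst (1 2) pairing_eq_sum[OF chainsD(1)[OF assms]]) (auto simp: sum_distrib_left algebra_simps)

lemma pairing_diff_right:
  assumes "c \<in> chains G n" "d \<in> chains G n"
  shows "pairing \<phi> (\<lambda>x. c x - d x) = pairing \<phi> c - pairing \<phi> d"
  using pairing_add_right[OF assms(1) chains_scale[OF assms(2), of "-1"]]
    pairing_scale_right[OF assms(2), of _ "-1"] by simp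

lemma pairing_add_left: "pairing (\<lambda>x. \<phi> x + \<psi> x) c = pairing \<phi> c + pairing \<psi> c"
  by (simp add: pairing_def sum.distrib algebra_simps)

lemma pairing_scale_left: "pairing (\<lambda>x. a * \<phi> x) c = a * pairing \<phi> c"
  by (simp add: pairing_def sum_distrib_left algebra_simps)

lemma pairing_single: "pairing \<phi> (\<lambda>x. if x = y then 1 else 0) = \<phi> y"
  by (simp add: pairing_def)

section \<open>The boundary operator and its adjoint\<close>

lemma bd_eq_sum:
  assumes "finite A" "{x. c x \<noteq> 0} \<subseteq> A"
  shows "bd G c y = (\<Sum>x\<in>A. \<Sum>i\<in>{0..length x}. if face G x i = y then (-1) ^ i * c x else 0)"
  unfolding bd_def by (rule sum.mono_neutral_left) (use assms in \<open>auto intro!: sum.neutral split: if_splits\<close>)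

lemma bd_add:
  assumes "c \<in> chains G n" "d \<in> chains G n"
  shows "bd G (\<lambda>x. c x + d x) = (\<lambda>x. bd G c x + bd G d x)"
proof
  fix y
  let ?A = "{x. c x \<noteq> 0} \<union> {x. d x \<noteq> 0}"
  have A: "finite ?A" using assms chainsD(1) by blast
  show "bd G (\<lambda>x. c x + d x) y = bd G c y + bd G d y"
    by (subst (1 2 3) bd_eq_sum[OF A])
      (auto simp: algebra_simps simp flip: sum.distrib intro!: sum.cong)
qed

lemma bd_scale:
  assumes "c \<in> chains G n"
  shows "bd G (\<lambda>x. a * c x) = (\<lambda>x. a * bd G c x)"
proof
  fix y
  show "bd G (\<lambda>x. a * c x) y = a * bd G c y"
    by (subst (1 2) bd_eq_sum[OF chainsD(1)[OF assms]])
      (auto simp: sum_distrib_left algebra_simps intro!: sum.cong)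
qed

lemma boundaries_zero: "(\<lambda>_. 0) \<in> boundaries G n"
proof -
  have "bd G (\<lambda>_. 0) = (\<lambda>_. 0)" by (simp add: bd_def)
  then show ?thesis unfolding boundaries_def using chains_zero by (metis imageI)
qed

lemma boundaries_add:
  assumes "b \<in> boundaries G n" "b' \<in> boundaries G n"
  shows "(\<lambda>x. b x + b' x) \<in> boundaries G n"
proof -
  obtain c c' where "c \<in> chains G (Suc n)" "c' \<in> chains G (Suc n)" "b = bd G c" "b' = bd G c'"
    using assms unfolding boundaries_def by blast
  then show ?thesis
    unfolding boundaries_def by (intro image_eqI[of _ _ "\<lambda>x. c x + c' x"]) (simp_all add: bd_add chains_add)
qed

lemma boundaries_scale:
  assumes "b \<in> boundaries G n"
  shows "(\<lambda>x. a * b x) \<in> boundaries G n"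
proof -
  obtain c where "c \<in> chains G (Suc n)" "b = bd G c"
    using assms unfolding boundaries_def by blast
  then show ?thesis
    unfolding boundaries_def by (intro image_eqI[of _ _ "\<lambda>x. a * c x"]) (simp_all add: bd_scale chains_scale)
qed

lemma bd_outside:
  assumes "\<And>x i. c x \<noteq> 0 \<Longrightarrow> i \<le> length x \<Longrightarrow> face G x i \<noteq> y"
  shows "bd G c y = 0"
  unfolding bd_def using assms by (auto intro!: sum.neutral)

lemma bd_support:
  "{y. bd G c y \<noteq> 0} \<subseteq> (\<Union>x\<in>{x. c x \<noteq> 0}. face G x ` {0..length x})"
proof
  fix y assume "y \<in> {y. bd G c y \<noteq> 0}"
  then obtain x i where "c x \<noteq> 0" "i \<le> length x" "face G x i = y"
    using bd_outside[of c G y] by blast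
  then show "y \<in> (\<Union>x\<in>{x. c x \<noteq> 0}. face G x ` {0..length x})" by auto
qed

text \<open>Both sides expand to the same sum over simplices and their faces: after exchanging sums,
  the one over \<open>y\<close> keeps only the term \<open>y = face G x i\<close>. All passages
  between cycles and coboundaries rest on this adjointness.\<close>

lemma pairing_bd:
  assumes "c \<in> chains G (Suc n)"
  shows "pairing \<phi> (bd G c) = pairing (cob G n \<phi>) c"
proof -
  let ?A = "{x. c x \<noteq> 0}"
  let ?Y = "\<Union>x\<in>?A. face G x ` {0..length x}"
  have A: "finite ?A" using assms by (rule chainsD)
  then have Y: "finite ?Y" by blast
  have "pairing \<phi> (bd G c) = (\<Sum>y\<in>?Y. bd G c y * \<phi> y)"
    by (rule pairing_eq_sum[OF Y bd_support])
  also have "\<dots> = (\<Sum>y\<in>?Y. \<Sum>x\<in>?A. \<Sum>i\<in>{0..length x}.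
      if face G x i = y then (-1) ^ i * c x * \<phi> y else 0)"
    unfolding bd_def sum_distrib_right by (intro sum.cong refl) auto
  also have "\<dots> = (\<Sum>x\<in>?A. \<Sum>i\<in>{0..length x}. \<Sum>y\<in>?Y.
      if face G x i = y then (-1) ^ i * c x * \<phi> y else 0)"
    by (subst sum.swap, intro sum.cong refl, subst sum.swap, rule refl)
  also have "\<dots> = (\<Sum>x\<in>?A. \<Sum>i\<in>{0..length x}. (-1) ^ i * c x * \<phi> (face G x i))"
    by (intro sum.cong refl) (subst sum.delta'[OF Y], auto)
  also have "\<dots> = (\<Sum>x\<in>?A. c x * cob G n \<phi> x)"
  proof (rule sum.cong)
    fix x assume "x \<in> ?A"
    then have "x \<in> lists (carrier G)" "length x = Suc n" using assms chainsD by blast+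
    then show "(\<Sum>i\<in>{0..length x}. (-1) ^ i * c x * \<phi> (face G x i)) = c x * cob G n \<phi> x"
      unfolding cob_def by (simp add: sum_distrib_left algebra_simps del: sum.cl_ivl_Suc)
  qed simp
  finally show ?thesis by (simp add: pairing_def)
qed

section \<open>Coboundaries, with explicit formulas in degrees one and two\<close>

lemma cochains_add: "\<phi> \<in> cochains G n \<Longrightarrow> \<psi> \<in> cochains G n \<Longrightarrow> (\<lambda>x. \<phi> x + \<psi> x) \<in> cochains G n"
  by (simp add: cochains_def) (metis add.right_neutral)

lemma cochains_scale: "\<phi> \<in> cochains G n \<Longrightarrow> (\<lambda>x. a * \<phi> x) \<in> cochains G n"
  by (simp add: cochains_def)

lemma cob_in_cochains: "cob G n \<phi> \<in> cochains G (Suc n)"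
  by (simp add: cochains_def cob_def)

lemma cob_add: "cob G n (\<lambda>x. \<phi> x + \<psi> x) = (\<lambda>x. cob G n \<phi> x + cob G n \<psi> x)"
  unfolding cob_def by (auto simp: fun_eq_iff sum.distrib algebra_simps)

lemma cob_scale: "cob G n (\<lambda>x. a * \<phi> x) = (\<lambda>x. a * cob G n \<phi> x)"
  unfolding cob_def by (auto simp: fun_eq_iff sum_distrib_left algebra_simps)

lemma cob_1:
  "g \<in> carrier G \<Longrightarrow> h \<in> carrier G \<Longrightarrow> cob G 1 \<psi> [g, h] = \<psi> [h] - \<psi> [g \<otimes>\<^bsub>G\<^esub> h] + \<psi> [g]"
  by (simp add: cob_def face_def numeral_2_eq_2)

lemma cob_2:
  "g \<in> carrier G \<Longrightarrow> h \<in> carrier G \<Longrightarrow> k \<in> carrier G \<Longrightarrow>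
    cob G 2 \<phi> [g, h, k] = \<phi> [h, k] - \<phi> [g \<otimes>\<^bsub>G\<^esub> h, k] + \<phi> [g, h \<otimes>\<^bsub>G\<^esub> k] - \<phi> [g, h]"
  by (simp add: cob_def face_def numeral_2_eq_2 numeral_3_eq_3)

lemma cochains_2_eqI:
  assumes "\<phi> \<in> cochains G 2" "\<psi> \<in> cochains G 2"
    and "\<And>g h. g \<in> carrier G \<Longrightarrow> h \<in> carrier G \<Longrightarrow> \<phi> [g, h] = \<psi> [g, h]"
  shows "\<phi> = \<psi>"
proof
  fix x
  show "\<phi> x = \<psi> x"
  proof (cases "x \<in> lists (carrier G) \<and> length x = 2")
    case True
    then obtain g h where "x = [g, h]" by (auto simp: numeral_2_eq_2 length_Suc_conv)
    then show ?thesis using True assms(3) by simp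
  next
    case False
    then have "\<phi> x = 0" "\<psi> x = 0" using assms(1,2) unfolding cochains_def by blast+
    then show ?thesis by simp
  qed
qed

lemma (in group) cob_cob_1: "cob G 2 (cob G 1 \<psi>) = (\<lambda>_. 0)"
proof
  fix x
  show "cob G 2 (cob G 1 \<psi>) x = 0"
  proof (cases "x \<in> lists (carrier G) \<and> length x = Suc 2")
    case True
    then obtain g h k where "x = [g, h, k]" by (auto simp: numeral_2_eq_2 length_Suc_conv)
    then show ?thesis using True by (simp add: cob_2 cob_1 m_assoc del: One_nat_def)
  next
    case False
    then show ?thesis unfolding cob_def[of G 2] by (simp only: if_not_P if_False)
  qed
qed

section \<open>Polynomial growth\<close>

lemma poly_growthE:
  assumes "poly_growth G L \<phi>"
  obtains C :: rat and k where "C \<ge> 0"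
    "\<And>gs. gs \<in> lists (carrier G) \<Longrightarrow> \<bar>\<phi> gs\<bar> \<le> C * (1 + of_nat (sum_list (map L gs))) ^ k"
proof -
  obtain C k where C: "\<forall>gs\<in>lists (carrier G). \<bar>\<phi> gs\<bar> \<le> C * (1 + of_nat (sum_list (map L gs))) ^ k"
    using assms unfolding poly_growth_def by blast
  \<comment> \<open>At the empty list the right-hand side of the bound is \<open>C\<close>
    itself.\<close>
  have "C \<ge> 0" using C[THEN bspec, of "[]"] by simp
  with C that show thesis by blast
qed

lemma poly_growth_add:
  assumes "poly_growth G L \<phi>" "poly_growth G L \<psi>"
  shows "poly_growth G L (\<lambda>x. \<phi> x + \<psi> x)"
proof -
  obtain C k where C: "C \<ge> 0" and \<phi>:
    "\<And>gs. gs \<in> lists (carrier G) \<Longrightarrow> \<bar>\<phi> gs\<bar> \<le> C * (1 + of_nat (sum_list (map L gs))) ^ k"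
    using poly_growthE[OF assms(1)] by metis
  obtain D l where D: "D \<ge> 0" and \<psi>:
    "\<And>gs. gs \<in> lists (carrier G) \<Longrightarrow> \<bar>\<psi> gs\<bar> \<le> D * (1 + of_nat (sum_list (map L gs))) ^ l"
    using poly_growthE[OF assms(2)] by metis
  have "\<bar>\<phi> gs + \<psi> gs\<bar> \<le> (C + D) * (1 + of_nat (sum_list (map L gs))) ^ (k + l)"
    if gs: "gs \<in> lists (carrier G)" for gs
  proof -
    let ?n = "1 + of_nat (sum_list (map L gs)) :: rat"
    \<comment> \<open>The base is at least 1, so both bounds may be raised to the exponent
      \<open>k + l\<close>.\<close>
    have "C * ?n ^ k \<le> C * ?n ^ (k + l)" "D * ?n ^ l \<le> D * ?n ^ (k + l)"
      using C D by (auto intro!: mult_left_mono power_increasing)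
    then show ?thesis using \<phi>[OF gs] \<psi>[OF gs] by (simp add: algebra_simps)
  qed
  then show ?thesis unfolding poly_growth_def by blast
qed

lemma poly_growth_scale:
  assumes "poly_growth G L \<phi>"
  shows "poly_growth G L (\<lambda>x. a * \<phi> x)"
proof -
  obtain C k where C: "C \<ge> 0" and \<phi>:
    "\<And>gs. gs \<in> lists (carrier G) \<Longrightarrow> \<bar>\<phi> gs\<bar> \<le> C * (1 + of_nat (sum_list (map L gs))) ^ k"
    using poly_growthE[OF assms] by metis
  have "\<bar>a * \<phi> gs\<bar> \<le> (\<bar>a\<bar> * C) * (1 + of_nat (sum_list (map L gs))) ^ k"
    if gs: "gs \<in> lists (carrier G)" for gs
    using mult_left_mono[OF \<phi>[OF gs], of "\<bar>a\<bar>"] by (simp add: abs_mult mult.assoc)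
  then show ?thesis unfolding poly_growth_def by blast
qed

lemma poly_growth_single: "poly_growth G L (\<lambda>x. if x = y then 1 else 0)"
  unfolding poly_growth_def by (rule exI[of _ 1], rule exI[of _ 0]) simp

text \<open>\<open>poly_growth\<close> ranges over lists of every length; off its own degree a
  cochain is 0, and \<open>C \<ge> 0\<close> takes care of those lists.\<close>

lemma poly_growth_1I:
  assumes "\<psi> \<in> cochains G 1" "C \<ge> 0"
    and "\<And>g. g \<in> carrier G \<Longrightarrow> \<bar>\<psi> [g]\<bar> \<le> C * (1 + of_nat (L g)) ^ k"
  shows "poly_growth G L \<psi>"
proof -
  have "\<bar>\<psi> x\<bar> \<le> C * (1 + of_nat (sum_list (map L x))) ^ k" if x: "x \<in> lists (carrier G)" for x
  proof (cases "\<psi> x = 0")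
    case False
    then have "length x = 1" using assms(1) by (auto simp: cochains_def)
    then obtain g where "x = [g]" by (auto simp: length_Suc_conv)
    then show ?thesis using assms(3) x by simp
  qed (use assms(2) in simp)
  then show ?thesis unfolding poly_growth_def by blast
qed

lemma poly_growth_2I:
  assumes "\<phi> \<in> cochains G 2" "C \<ge> 0"
    and "\<And>g h. g \<in> carrier G \<Longrightarrow> h \<in> carrier G \<Longrightarrow> \<bar>\<phi> [g, h]\<bar> \<le> C * (1 + of_nat (L g + L h)) ^ k"
  shows "poly_growth G L \<phi>"
proof -
  have "\<bar>\<phi> x\<bar> \<le> C * (1 + of_nat (sum_list (map L x))) ^ k" if x: "x \<in> lists (carrier G)" for x
  proof (cases "\<phi> x = 0")
    case False
    then have "length x = 2" using assms(1) by (auto simp: cochains_def)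
    then obtain g h where "x = [g, h]" by (auto simp: numeral_2_eq_2 length_Suc_conv)
    then show ?thesis using assms(3) x by simp
  qed (use assms(2) in simp)
  then show ?thesis unfolding poly_growth_def by blast
qed

text \<open>The coboundary has three terms, and subadditivity of \<open>L\<close> bounds the one at
  \<open>g \<otimes> h\<close>; this gives the constant \<open>3 * C\<close>.\<close>

lemma (in group) poly_growth_cob_1:
  assumes "poly_growth G L \<psi>"
    and L: "\<And>g h. g \<in> carrier G \<Longrightarrow> h \<in> carrier G \<Longrightarrow> L (g \<otimes> h) \<le> L g + L h"
  shows "poly_growth G L (cob G 1 \<psi>)"
proof -
  obtain C k where C: "C \<ge> 0" and \<psi>:
    "\<And>gs. gs \<in> lists (carrier G) \<Longrightarrow> \<bar>\<psi> gs\<bar> \<le> C * (1 + of_nat (sum_list (map L gs))) ^ k"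
    using poly_growthE[OF assms(1)] by metis
  show ?thesis
  proof (rule poly_growth_2I[of _ _ "3 * C"])
    show "cob G 1 \<psi> \<in> cochains G 2" using cob_in_cochains[of G 1] by (simp add: numeral_2_eq_2)
  next
    fix g h assume gh: "g \<in> carrier G" "h \<in> carrier G"
    have "\<bar>\<psi> [x]\<bar> \<le> C * (1 + of_nat (L g + L h)) ^ k" if "x \<in> carrier G" "L x \<le> L g + L h" for x
    proof -
      have "\<bar>\<psi> [x]\<bar> \<le> C * (1 + of_nat (L x)) ^ k" using \<psi>[of "[x]"] that by simp
      also have "\<dots> \<le> C * (1 + of_nat (L g + L h)) ^ k"
        using C that(2) by (intro mult_left_mono power_mono add_left_mono of_nat_mono) simp_all
      finally show ?thesis .
    qed
    from this[of g] this[of h] this[of "g \<otimes> h"]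
    show "\<bar>cob G 1 \<psi> [g, h]\<bar> \<le> 3 * C * (1 + of_nat (L g + L h)) ^ k"
      using gh L[OF gh] unfolding cob_1[OF gh] by (simp del: of_nat_add)
  qed (use C in simp)
qed

lemma pcocycles_add:
  "\<phi> \<in> pcocycles G L n \<Longrightarrow> \<psi> \<in> pcocycles G L n \<Longrightarrow> (\<lambda>x. \<phi> x + \<psi> x) \<in> pcocycles G L n"
  by (simp add: pcocycles_def pcochains_def cochains_add poly_growth_add cob_add)

lemma pcocycles_scale: "\<phi> \<in> pcocycles G L n \<Longrightarrow> (\<lambda>x. a * \<phi> x) \<in> pcocycles G L n"
  by (simp add: pcocycles_def pcochains_def cochains_scale poly_growth_scale cob_scale)

lemma pcoboundaries_2: "pcoboundaries G L 2 = cob G 1 ` pcochains G L 1"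
  by (simp add: pcoboundaries_def numeral_2_eq_2)

section \<open>The central extension defined by a cocycle\<close>

text \<open>The extension of G by the additive rationals with factor set \<open>\<phi>\<close>. The
  first coordinate of the unit compensates for the value of \<open>\<phi>\<close> at the pair of
  units, which may be nonzero.\<close>

definition central_ext :: "('g, 'b) monoid_scheme \<Rightarrow> ('g list \<Rightarrow> rat) \<Rightarrow> (rat \<times> 'g) monoid" where
  "central_ext G \<phi> = \<lparr>carrier = UNIV \<times> carrier G,
     mult = (\<lambda>(a, g) (b, h). (a + b + \<phi> [g, h], g \<otimes>\<^bsub>G\<^esub> h)),
     one = (- \<phi> [\<one>\<^bsub>G\<^esub>, \<one>\<^bsub>G\<^esub>], \<one>\<^bsub>G\<^esub>)\<rparr>"

text \<open>The rational coordinate of a word evaluated in the extension, each generator being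
  lifted with coordinate 0.\<close>

definition lift :: "('g, 'b) monoid_scheme \<Rightarrow> ('a \<Rightarrow> 'g) \<Rightarrow> ('g list \<Rightarrow> rat) \<Rightarrow> 'a word \<Rightarrow> rat" where
  "lift G gen \<phi> w = fst (eval_word (central_ext G \<phi>) (\<lambda>s. (0, gen s)) w)"

text \<open>The cocycle need not be normalised, so the fibre over 1 is identified with the rationals by
  sending the unit of the extension to 0.\<close>

definition fibre :: "('g, 'b) monoid_scheme \<Rightarrow> ('a \<Rightarrow> 'g) \<Rightarrow> ('g list \<Rightarrow> rat) \<Rightarrow> 'a word \<Rightarrow> rat" where
  "fibre G gen \<phi> w = lift G gen \<phi> w + \<phi> [\<one>\<^bsub>G\<^esub>, \<one>\<^bsub>G\<^esub>]"

locale two_cocycle = group G for G :: "('g, 'b) monoid_scheme" (structure) +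
  fixes \<phi> :: "'g list \<Rightarrow> rat" and gen :: "'a \<Rightarrow> 'g" and S :: "'a set"
  assumes cob_zero: "cob G 2 \<phi> = (\<lambda>_. 0)" and gen: "gen \<in> S \<rightarrow> carrier G"
begin

abbreviation E where "E \<equiv> central_ext G \<phi>"

lemma cocycle_eq:
  assumes "g \<in> carrier G" "h \<in> carrier G" "k \<in> carrier G"
  shows "\<phi> [h, k] + \<phi> [g, h \<otimes> k] = \<phi> [g \<otimes> h, k] + \<phi> [g, h]"
  using cob_2[OF assms, of \<phi>] by (simp add: cob_zero)

definition c0 where "c0 = \<phi> [\<one>, \<one>]"

text \<open>The cocycle identity at the triple \<open>\<one>, \<one>, g\<close> compares this value
  with \<open>c0\<close>; with its mirror image it replaces normalisation of
  \<open>\<phi>\<close>.\<close>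

lemma cocycle_one_left [simp]: "g \<in> carrier G \<Longrightarrow> \<phi> [\<one>, g] = c0"
  using cocycle_eq[of \<one> \<one> g] by (simp add: c0_def)

lemma cocycle_one_right [simp]: "g \<in> carrier G \<Longrightarrow> \<phi> [g, \<one>] = c0"
  using cocycle_eq[of g \<one> \<one>] by simp

lemma E_simps [simp]:
  "(a, g) \<otimes>\<^bsub>E\<^esub> (b, h) = (a + b + \<phi> [g, h], g \<otimes> h)"
  "\<one>\<^bsub>E\<^esub> = (- c0, \<one>)"
  "(a, g) \<in> carrier E \<longleftrightarrow> g \<in> carrier G"
  by (simp_all add: central_ext_def)

text \<open>Associativity in the first coordinate is exactly the cocycle identity.\<close>

lemma group_E: "group E"
proof (rule groupI)
  fix x y z assume "x \<in> carrier E" "y \<in> carrier E" "z \<in> carrier E"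
  then show "x \<otimes>\<^bsub>E\<^esub> y \<otimes>\<^bsub>E\<^esub> z = x \<otimes>\<^bsub>E\<^esub> (y \<otimes>\<^bsub>E\<^esub> z)"
    using cocycle_eq by (cases x, cases y, cases z) (auto simp: m_assoc)
next
  fix x assume x: "x \<in> carrier E"
  obtain a g where ag: "x = (a, g)" "g \<in> carrier G" using x by (cases x) auto
  show "\<exists>y\<in>carrier E. y \<otimes>\<^bsub>E\<^esub> x = \<one>\<^bsub>E\<^esub>"
    \<comment> \<open>The first coordinate solves \<open>b + a + \<phi> [inv g, g] = - c0\<close>,
      the coordinate of the unit.\<close>
    by (rule bexI[of _ "(- a - c0 - \<phi> [inv g, g], inv g)"]) (use ag in auto)
qed auto

sublocale E: group E by (fact group_E)

lemma inv_E: "g \<in> carrier G \<Longrightarrow> inv\<^bsub>E\<^esub> (a, g) = (- a - c0 - \<phi> [inv g, g], inv g)"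
  by (rule E.inv_equality) auto

lemma gen_E: "(\<lambda>s. (0, gen s)) \<in> S \<rightarrow> carrier E"
  using gen by auto

lemma eval_word_E:
  "w \<in> words S \<Longrightarrow> eval_word E (\<lambda>s. (0, gen s)) w = (lift G gen \<phi> w, eval_word G gen w)"
proof (induction w)
  case Nil
  then show ?case by (simp add: lift_def)
next
  case (Cons x w)
  obtain s b where x: "x = (s, b)" by fastforce
  have "gen s \<in> carrier G" using gen Cons.prems x by auto
  then have "snd (eval_word E (\<lambda>s. (0, gen s)) (x # w)) = eval_word G gen (x # w)"
    using Cons x by (simp add: eval_word_Cons inv_E)
  then show ?case by (simp add: lift_def prod_eq_iff)
qed

lemma lift_Nil: "lift G gen \<phi> [] = - \<phi> [\<one>, \<one>]"
  by (simp add: lift_def)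

text \<open>Unfolding one product in the extension, and \<open>inv_E\<close> for an inverse letter.
  The recursion shows that a lift is a fixed integer combination of values of \<open>\<phi>\<close>;
  the growth bound and the representation by chains both use it.\<close>

lemma lift_Cons:
  assumes "s \<in> S" "w \<in> words S"
  shows "lift G gen \<phi> ((s, b) # w) =
    (if b then lift G gen \<phi> w + \<phi> [gen s, eval_word G gen w]
     else lift G gen \<phi> w + \<phi> [inv (gen s), eval_word G gen w] - \<phi> [\<one>, \<one>] - \<phi> [inv (gen s), gen s])"
proof -
  have "gen s \<in> carrier G" using gen assms(1) by auto
  then show ?thesis
    using eval_word_E[OF assms(2)] by (simp add: lift_def[of _ _ _ "(s, b) # w"] eval_word_Cons inv_E)
qed

text \<open>After the shift by \<open>c0\<close>, the fibre over the unit is a copy of the rationals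
  acting by translation, because \<open>\<phi>\<close> equals \<open>c0\<close> whenever one
  argument is the unit.\<close>

lemma fibre_central:
  assumes "g \<in> carrier G"
  shows "(a - c0, \<one>) \<otimes>\<^bsub>E\<^esub> (b, g) = (a + b, g)" "(b, g) \<otimes>\<^bsub>E\<^esub> (a - c0, \<one>) = (a + b, g)"
  using assms by simp_all

lemma eval_word_E_kernel:
  assumes "w \<in> words S" "eval_word G gen w = \<one>"
  shows "eval_word E (\<lambda>s. (0, gen s)) w = (fibre G gen \<phi> w - c0, \<one>)"
  using assms eval_word_E by (simp add: fibre_def)

text \<open>Relators take central values in the extension, so the conjugators cancel and the values
  add up, with a minus sign for inverted relators.\<close>

lemma eval_word_E_conj_prod:
  assumes "\<And>x r e. (x, r, e) \<in> set cs \<Longrightarrow> x \<in> words S \<and> r \<in> words S \<and> eval_word G gen r = \<one>"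
  shows "conj_prod cs \<in> words S \<and> eval_word E (\<lambda>s. (0, gen s)) (conj_prod cs) =
    ((\<Sum>(x, r, e)\<leftarrow>cs. if e then fibre G gen \<phi> r else - fibre G gen \<phi> r) - c0, \<one>)"
  using assms
proof (induction cs)
  case Nil
  then show ?case by (simp add: conj_prod_def)
next
  case (Cons y cs)
  obtain x r e where y: "y = (x, r, e)" by (cases y)
  let ?ev = "eval_word E (\<lambda>s. (0, gen s))"
  let ?q = "if e then r else inv_word r"
  let ?a = "if e then fibre G gen \<phi> r else - fibre G gen \<phi> r"
  have x: "x \<in> words S" and r: "r \<in> words S" "eval_word G gen r = \<one>"
    using Cons.prems[of x r e] y by auto
  have IH: "conj_prod cs \<in> words S" "?ev (conj_prod cs) =
    ((\<Sum>(x, r, e)\<leftarrow>cs. if e then fibre G gen \<phi> r else - fibre G gen \<phi> r) - c0, \<one>)"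
    using Cons by (meson list.set_intros(2))+
  have q: "?q \<in> words S" using r by simp
  have cp: "conj_prod (y # cs) = x @ ?q @ inv_word x @ conj_prod cs"
    by (simp add: conj_prod_def y)
  have evq: "?ev ?q = (?a - c0, \<one>)"
    using eval_word_E_kernel[OF r] E.eval_word_inv_word[OF gen_E r(1)] inv_E[OF one_closed] by simp
  obtain b g where X: "?ev x = (b, g)" "g \<in> carrier G"
    using E.eval_word_closed[OF gen_E x] by (cases "?ev x") auto
  have XX: "inv\<^bsub>E\<^esub> (b, g) \<in> carrier E" using X by simp
  have "?ev (conj_prod (y # cs)) = (b, g) \<otimes>\<^bsub>E\<^esub> ((?a - c0, \<one>) \<otimes>\<^bsub>E\<^esub> (inv\<^bsub>E\<^esub> (b, g) \<otimes>\<^bsub>E\<^esub> ?ev (conj_prod cs)))"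
    unfolding cp using E.eval_word_append[OF gen_E] E.eval_word_inv_word[OF gen_E x] x q IH(1) X evq by simp
  also have "\<dots> = ((b, g) \<otimes>\<^bsub>E\<^esub> (?a - c0, \<one>)) \<otimes>\<^bsub>E\<^esub> (inv\<^bsub>E\<^esub> (b, g) \<otimes>\<^bsub>E\<^esub> ?ev (conj_prod cs))"
    by (rule E.m_assoc[symmetric]) (use X XX E.eval_word_closed[OF gen_E IH(1)] in auto)
  \<comment> \<open>Centrality moves the relator value to the left, so that the value of the
    conjugator meets its inverse.\<close>
  also have "(b, g) \<otimes>\<^bsub>E\<^esub> (?a - c0, \<one>) = (?a - c0, \<one>) \<otimes>\<^bsub>E\<^esub> (b, g)"
    using fibre_central[OF X(2)] by metis
  also have "\<dots> \<otimes>\<^bsub>E\<^esub> (inv\<^bsub>E\<^esub> (b, g) \<otimes>\<^bsub>E\<^esub> ?ev (conj_prod cs)) =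
      (?a - c0, \<one>) \<otimes>\<^bsub>E\<^esub> ((b, g) \<otimes>\<^bsub>E\<^esub> (inv\<^bsub>E\<^esub> (b, g) \<otimes>\<^bsub>E\<^esub> ?ev (conj_prod cs)))"
    by (rule E.m_assoc) (use X XX E.eval_word_closed[OF gen_E IH(1)] in auto)
  also have "(b, g) \<otimes>\<^bsub>E\<^esub> (inv\<^bsub>E\<^esub> (b, g) \<otimes>\<^bsub>E\<^esub> ?ev (conj_prod cs)) = ?ev (conj_prod cs)"
    using X E.eval_word_closed[OF gen_E IH(1)] E.m_assoc[of "(b, g)" "inv\<^bsub>E\<^esub> (b, g)" "?ev (conj_prod cs)", symmetric]
      XX E.r_inv[of "(b, g)"] E.l_one by simp
  finally have "?ev (conj_prod (y # cs)) = (?a - c0, \<one>) \<otimes>\<^bsub>E\<^esub> ?ev (conj_prod cs)" .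
  then show ?case using cp x q IH by (simp add: y)
qed

text \<open>Freely equivalent words have the same value in the group \<open>E\<close>, so
  \<open>w\<close> may be replaced by its product of conjugates.\<close>

lemma fibre_conj_decomp:
  assumes "conj_decomp S W w cs" "w \<in> words S" "W \<subseteq> words S" "\<And>r. r \<in> W \<Longrightarrow> eval_word G gen r = \<one>"
  shows "fibre G gen \<phi> w = (\<Sum>(x, r, e)\<leftarrow>cs. if e then fibre G gen \<phi> r else - fibre G gen \<phi> r)"
proof -
  have cs: "x \<in> words S \<and> r \<in> words S \<and> eval_word G gen r = \<one>" if "(x, r, e) \<in> set cs" for x r e
    using that assms(1,3,4) unfolding conj_decomp_def by blast
  note cp = eval_word_E_conj_prod[of cs, OF cs]
  have "eval_word E (\<lambda>s. (0, gen s)) w = eval_word E (\<lambda>s. (0, gen s)) (conj_prod cs)"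
    using assms(1,2) cp unfolding conj_decomp_def by (intro E.eval_word_free_eq[OF _ gen_E]) auto
  then show ?thesis using cp by (simp add: fibre_def lift_def)
qed

lemma fibre_conj_decomp_bound:
  assumes "conj_decomp S W w cs" "w \<in> words S" "W \<subseteq> words S" "\<And>r. r \<in> W \<Longrightarrow> eval_word G gen r = \<one>"
    and "\<And>r. r \<in> W \<Longrightarrow> \<bar>fibre G gen \<phi> r\<bar> \<le> M"
  shows "\<bar>fibre G gen \<phi> w\<bar> \<le> of_nat (length cs) * M"
proof -
  have "\<forall>(x, r, e)\<in>set cs. r \<in> W" using assms(1) by (auto simp: conj_decomp_def)
  then have "\<bar>\<Sum>(x, r, e)\<leftarrow>cs. if e then fibre G gen \<phi> r else - fibre G gen \<phi> r\<bar> \<le> of_nat (length cs) * M"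
  proof (induction cs)
    case (Cons y cs)
    obtain x r e where y: "y = (x, r, e)" by (cases y)
    have "\<bar>fibre G gen \<phi> r\<bar> \<le> M" using Cons.prems assms(5) y by auto
    with Cons show ?case by (auto simp: y algebra_simps)
  qed simp
  then show ?thesis using fibre_conj_decomp[OF assms(1-4)] by simp
qed

text \<open>Replacing the section \<open>g -> (0, g)\<close> of the extension by the values of the
  words \<open>nf g\<close> changes the factor set by a coboundary; the new factor set is the fibre
  of the defect word.\<close>

lemma cocycle_eq_fibre:
  assumes nf: "\<And>g. g \<in> carrier G \<Longrightarrow> nf g \<in> words S \<and> eval_word G gen (nf g) = g"
    and gh: "g \<in> carrier G" "h \<in> carrier G"
  shows "\<phi> [g, h] = fibre G gen \<phi> (nf g @ nf h @ inv_word (nf (g \<otimes> h)))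
    - lift G gen \<phi> (nf g) - lift G gen \<phi> (nf h) + lift G gen \<phi> (nf (g \<otimes> h))"
proof -
  let ?ev = "eval_word E (\<lambda>s. (0, gen s))"
  let ?u = "nf g @ nf h @ inv_word (nf (g \<otimes> h))"
  have k: "g \<otimes> h \<in> carrier G" using gh by simp
  note w = nf[OF gh(1)] nf[OF gh(2)] nf[OF k]
  have u: "?u \<in> words S" using w by simp
  have "eval_word G gen ?u = g \<otimes> (h \<otimes> inv (g \<otimes> h))"
    using w by (simp add: eval_word_append[OF gen] eval_word_inv_word[OF gen])
  also have "\<dots> = \<one>" using gh k by (simp add: m_assoc[symmetric])
  finally have u1: "eval_word G gen ?u = \<one>" .
  have ev: "?ev (nf g) = (lift G gen \<phi> (nf g), g)" "?ev (nf h) = (lift G gen \<phi> (nf h), h)"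
    "?ev (nf (g \<otimes> h)) = (lift G gen \<phi> (nf (g \<otimes> h)), g \<otimes> h)"
    using w eval_word_E by auto
  \<comment> \<open>The trailing inverse in \<open>?u\<close> cancels; comparing first coordinates
    of both sides then gives the claim.\<close>
  have "?ev ?u \<otimes>\<^bsub>E\<^esub> ?ev (nf (g \<otimes> h)) = ?ev (nf g) \<otimes>\<^bsub>E\<^esub> ?ev (nf h)"
  proof -
    have c: "?ev (nf g) \<in> carrier E" "?ev (nf h) \<in> carrier E" "?ev (nf (g \<otimes> h)) \<in> carrier E"
      using w E.eval_word_closed[OF gen_E] by auto
    have "?ev ?u = ?ev (nf g) \<otimes>\<^bsub>E\<^esub> (?ev (nf h) \<otimes>\<^bsub>E\<^esub> inv\<^bsub>E\<^esub> (?ev (nf (g \<otimes> h))))"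
      using w by (simp only: E.eval_word_append[OF gen_E] E.eval_word_inv_word[OF gen_E] words_append words_inv_word)
    then show ?thesis
      using c by (simp only: E.m_assoc E.m_closed E.inv_closed E.l_inv E.r_one)
  qed
  then show ?thesis
    unfolding eval_word_E_kernel[OF u u1] ev fibre_central[OF k] by (simp add: k)
qed

end

section \<open>Word length and polynomial Dehn function\<close>

lemma std_length_eval_le: "w \<in> words S \<Longrightarrow> std_length G gen S (eval_word G gen w) \<le> length w"
  unfolding std_length_def by (rule Least_le) blast

lemma geodesic_word_exists:
  assumes "g \<in> eval_word G gen ` words S"
  shows "\<exists>w\<in>words S. length w = std_length G gen S g \<and> eval_word G gen w = g"
  unfolding std_length_def by (rule LeastI_ex) (use assms in blast)

locale fin_pres = group G for G :: "('g, 'b) monoid_scheme" (structure) +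
  fixes gen :: "'a \<Rightarrow> 'g" and S :: "'a set" and W :: "'a word set"
  assumes pres: "finite_presentation G gen S W"
begin

abbreviation L where "L \<equiv> std_length G gen S"

lemma fin_S: "finite S" and fin_W: "finite W" and W_words: "W \<subseteq> words S"
  and gen_closed: "gen \<in> S \<rightarrow> carrier G" and carrier_eq: "carrier G = eval_word G gen ` words S"
  and eval_one_iff: "w \<in> words S \<Longrightarrow> eval_word G gen w = \<one> \<longleftrightarrow> in_normal_closure S W w"
  using pres unfolding finite_presentation_def by auto

definition nf :: "'g \<Rightarrow> 'a word" where
  "nf g = (SOME w. w \<in> words S \<and> length w = L g \<and> eval_word G gen w = g)"

lemma nf:
  assumes "g \<in> carrier G"
  shows "nf g \<in> words S" "length (nf g) = L g" "eval_word G gen (nf g) = g"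
proof -
  have "\<exists>w. w \<in> words S \<and> length w = L g \<and> eval_word G gen w = g"
    using geodesic_word_exists[of g G gen S] assms carrier_eq by blast
  from someI_ex[OF this] show "nf g \<in> words S" "length (nf g) = L g" "eval_word G gen (nf g) = g"
    unfolding nf_def by auto
qed

lemma L_mult_le:
  assumes "g \<in> carrier G" "h \<in> carrier G"
  shows "L (g \<otimes> h) \<le> L g + L h"
  using std_length_eval_le[of "nf g @ nf h" S G gen] nf[OF assms(1)] nf[OF assms(2)]
  by (simp add: eval_word_append[OF gen_closed])

lemma L_one: "L \<one> = 0"
  using std_length_eval_le[of "[]" S G gen] by simp

lemma L_letter_le:
  assumes "s \<in> S"
  shows "L (gen s) \<le> 1" "L (inv (gen s)) \<le> 1"
proof -
  have "gen s \<in> carrier G" using assms gen_closed by auto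
  then show "L (gen s) \<le> 1" "L (inv (gen s)) \<le> 1"
    using std_length_eval_le[of "[(s, True)]" S G gen] std_length_eval_le[of "[(s, False)]" S G gen] assms
    by (simp_all add: eval_word_Cons)
qed

lemma relator_eval: "r \<in> W \<Longrightarrow> eval_word G gen r = \<one>"
proof -
  assume r: "r \<in> W"
  \<comment> \<open>A relator is its own product of conjugates, with empty conjugator.\<close>
  have "conj_decomp S W r [([], r, True)]"
    using r by (simp add: conj_decomp_def conj_prod_def free_eq_def inv_word_def)
  then show ?thesis using eval_one_iff r W_words unfolding in_normal_closure_def by blast
qed

lemma decomp_length_le_dehn:
  assumes "w \<in> words S" "eval_word G gen w = \<one>" "length w \<le> n"
  obtains cs where "conj_decomp S W w cs" "length cs \<le> dehn_function S W n"
proof -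
  have nc: "in_normal_closure S W w" using assms eval_one_iff by blast
  have "\<exists>m cs. length cs = m \<and> conj_decomp S W w cs" using nc by (auto simp: in_normal_closure_def)
  from LeastI_ex[OF this] obtain cs where cs: "length cs = area S W w" "conj_decomp S W w cs"
    unfolding area_def by blast
  \<comment> \<open>Over a finite alphabet the supremum in the Dehn function is taken over a finite
    set, so it really bounds each area.\<close>
  have "finite {w \<in> words S. length w \<le> n}"
  proof (rule finite_subset)
    show "{w \<in> words S. length w \<le> n} \<subseteq> {w. set w \<subseteq> S \<times> UNIV \<and> length w \<le> n}"
      by (auto simp: words_def)
    show "finite {w. set w \<subseteq> S \<times> (UNIV :: bool set) \<and> length w \<le> n}"
      by (rule finite_lists_length_le) (simp add: fin_S)
  qed
  then have "finite (area S W ` {w \<in> words S. length w \<le> n})" by blast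
  then have "finite {area S W w | w. w \<in> words S \<and> length w \<le> n \<and> in_normal_closure S W w}"
    by (rule finite_subset[rotated]) blast
  then have "area S W w \<le> dehn_function S W n"
    unfolding dehn_function_def by (rule le_cSup_finite) (use assms nc in blast)
  with cs that show thesis by simp
qed

lemma two_cocycleI: "cob G 2 \<phi> = (\<lambda>_. 0) \<Longrightarrow> two_cocycle G \<phi> gen S"
  by (unfold_locales) (simp_all add: gen_closed)

text \<open>The coordinate of the section of the extension given by geodesic words; its coboundary
  is the correction to \<open>\<phi>\<close>.\<close>

definition section_cochain :: "('g list \<Rightarrow> rat) \<Rightarrow> 'g list \<Rightarrow> rat" where
  "section_cochain \<phi> x =
     (if x \<in> lists (carrier G) \<and> length x = 1 then lift G gen \<phi> (nf (hd x)) else 0)"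

lemma section_cochain_in_cochains: "section_cochain \<phi> \<in> cochains G 1"
  by (simp add: section_cochain_def cochains_def)

lemma cocycle_plus_cob_section:
  assumes "cob G 2 \<phi> = (\<lambda>_. 0)" "g \<in> carrier G" "h \<in> carrier G"
  shows "\<phi> [g, h] + cob G 1 (section_cochain \<phi>) [g, h] =
    fibre G gen \<phi> (nf g @ nf h @ inv_word (nf (g \<otimes> h)))"
  using two_cocycle.cocycle_eq_fibre[OF two_cocycleI[OF assms(1)], of nf g h] nf assms(2,3)
  by (simp add: cob_1[OF assms(2,3), simplified] section_cochain_def)

lemma defect_word:
  assumes "g \<in> carrier G" "h \<in> carrier G"
  shows "nf g @ nf h @ inv_word (nf (g \<otimes> h)) \<in> words S"
    and "eval_word G gen (nf g @ nf h @ inv_word (nf (g \<otimes> h))) = \<one>"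
    and "length (nf g @ nf h @ inv_word (nf (g \<otimes> h))) \<le> 2 * (L g + L h)"
proof -
  have k: "g \<otimes> h \<in> carrier G" using assms by simp
  note w = nf[OF assms(1)] nf[OF assms(2)] nf[OF k]
  show "nf g @ nf h @ inv_word (nf (g \<otimes> h)) \<in> words S" using w by simp
  have "eval_word G gen (nf g @ nf h @ inv_word (nf (g \<otimes> h))) = g \<otimes> (h \<otimes> inv (g \<otimes> h))"
    using w by (simp add: eval_word_append[OF gen_closed] eval_word_inv_word[OF gen_closed])
  also have "\<dots> = \<one>" using assms k by (simp add: m_assoc[symmetric])
  finally show "eval_word G gen (nf g @ nf h @ inv_word (nf (g \<otimes> h))) = \<one>" .
  \<comment> \<open>The factor 2 arises because the third piece has length
    \<open>L (g \<otimes> h)\<close>, again at most \<open>L g + L h\<close>.\<close>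
  show "length (nf g @ nf h @ inv_word (nf (g \<otimes> h))) \<le> 2 * (L g + L h)"
    using w L_mult_le[OF assms] by simp
qed

text \<open>The new cocycle at (g, h) is a signed sum of as many relator values as the area of the defect word of (g, h).\<close>

lemma cocycle_cohomologous_poly_growth:
  assumes "polynomial_dehn S W" "\<phi> \<in> cochains G 2" "cob G 2 \<phi> = (\<lambda>_. 0)"
  shows "(\<lambda>x. \<phi> x + cob G 1 (section_cochain \<phi>) x) \<in> pcocycles G L 2"
proof -
  obtain C :: real and k where C: "\<And>n. real (dehn_function S W n) \<le> C * (1 + real n) ^ k"
    using assms(1) unfolding polynomial_dehn_def by blast
  \<comment> \<open>Rounding up to a natural number turns the real bound into one usable in
    \<open>poly_growth\<close>, whose constant is rational.\<close>
  define K where "K = nat \<lceil>\<bar>C\<bar>\<rceil>"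
  have K: "dehn_function S W n \<le> K * (1 + n) ^ k" for n
  proof -
    have "real (dehn_function S W n) \<le> C * (1 + real n) ^ k" by (fact C)
    also have "\<dots> \<le> real K * (1 + real n) ^ k"
      unfolding K_def by (rule mult_right_mono) (linarith, simp)
    also have "\<dots> = real (K * (1 + n) ^ k)" by simp
    finally show ?thesis by (simp only: of_nat_le_iff)
  qed
  interpret two_cocycle G \<phi> gen S by (rule two_cocycleI) (fact assms(3))
  \<comment> \<open>Finiteness of \<open>W\<close> gives one bound for all relator values.\<close>
  obtain M where M: "\<And>r. r \<in> W \<Longrightarrow> \<bar>fibre G gen \<phi> r\<bar> \<le> M" "M \<ge> 0"
  proof
    show "\<bar>fibre G gen \<phi> r\<bar> \<le> (\<Sum>r\<in>W. \<bar>fibre G gen \<phi> r\<bar>)" if "r \<in> W" for r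
      by (rule member_le_sum[OF that]) (simp_all add: fin_W)
  qed (simp add: sum_nonneg)
  let ?\<phi>' = "\<lambda>x. \<phi> x + cob G 1 (section_cochain \<phi>) x"
  have coch: "?\<phi>' \<in> cochains G 2"
    using cochains_add[OF assms(2)] cob_in_cochains[of G 1] by (simp add: numeral_2_eq_2)
  have "poly_growth G L ?\<phi>'"
  proof (rule poly_growth_2I[OF coch])
    show "0 \<le> M * of_nat (K * 2 ^ k)" using M(2) by simp
    fix g h assume gh: "g \<in> carrier G" "h \<in> carrier G"
    let ?n = "L g + L h"
    let ?u = "nf g @ nf h @ inv_word (nf (g \<otimes> h))"
    note u = defect_word[OF gh]
    obtain cs where cs: "conj_decomp S W ?u cs" "length cs \<le> dehn_function S W (2 * ?n)"
      using decomp_length_le_dehn[OF u] by blast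
    have "length cs \<le> K * (1 + 2 * ?n) ^ k" using cs(2) K le_trans by blast
    \<comment> \<open>The doubled length of the defect word costs only the constant factor
      \<open>2 ^ k\<close>.\<close>
    also have "\<dots> \<le> K * (2 * (1 + ?n)) ^ k" by (intro mult_left_mono power_mono) auto
    also have "\<dots> = K * 2 ^ k * (1 + ?n) ^ k" by (simp only: power_mult_distrib mult.assoc)
    finally have len: "length cs \<le> K * 2 ^ k * (1 + ?n) ^ k" .
    have "\<bar>?\<phi>' [g, h]\<bar> = \<bar>fibre G gen \<phi> ?u\<bar>"
      by (subst cocycle_plus_cob_section[OF assms(3) gh]) simp
    also have "\<dots> \<le> of_nat (length cs) * M"
      by (rule fibre_conj_decomp_bound[OF cs(1) u(1) W_words relator_eval M(1)])
    also have "\<dots> \<le> of_nat (K * 2 ^ k * (1 + ?n) ^ k) * M"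
      using M(2) len by (intro mult_right_mono of_nat_mono)
    also have "\<dots> = M * of_nat (K * 2 ^ k) * (1 + of_nat ?n) ^ k" by simp
    finally show "\<bar>?\<phi>' [g, h]\<bar> \<le> M * of_nat (K * 2 ^ k) * (1 + of_nat ?n) ^ k" .
  qed
  moreover have "cob G 2 ?\<phi>' = (\<lambda>_. 0)"
    by (simp only: cob_add assms(3) cob_cob_1) simp
  ultimately show ?thesis using coch by (simp add: pcocycles_def pcochains_def)
qed

text \<open>By \<open>lift_Cons\<close> each letter contributes at most three values of
  \<open>\<phi>\<close>, and the empty word contributes one; this is the factor
  \<open>1 + 3 * of_nat (length w)\<close>. The power bounds each single value.\<close>

lemma lift_bound:
  assumes cob: "cob G 2 \<phi> = (\<lambda>_. 0)" and C: "C \<ge> 0"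
    and \<phi>: "\<And>gs. gs \<in> lists (carrier G) \<Longrightarrow> \<bar>\<phi> gs\<bar> \<le> C * (1 + of_nat (sum_list (map L gs))) ^ k"
    and w: "w \<in> words S"
  shows "\<bar>lift G gen \<phi> w\<bar> \<le> C * (1 + 3 * of_nat (length w)) * (3 + of_nat (length w)) ^ k"
proof -
  interpret two_cocycle G \<phi> gen S by (rule two_cocycleI) (fact cob)
  \<comment> \<open>One bound serves all pairs that occur: two letters have total length at most 2,
    and a letter with the value of the remaining word at most one more than that word.\<close>
  have b: "\<bar>\<phi> [g, h]\<bar> \<le> C * (3 + of_nat m) ^ k"
    if "g \<in> carrier G" "h \<in> carrier G" "L g + L h \<le> 2 + m" for g h m
  proof -
    have "\<bar>\<phi> [g, h]\<bar> \<le> C * (1 + of_nat (L g + L h)) ^ k" using \<phi>[of "[g, h]"] that by simp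
    also have "\<dots> \<le> C * (1 + of_nat (2 + m)) ^ k"
      using C that(3) by (intro mult_left_mono power_mono add_left_mono of_nat_mono) auto
    finally show ?thesis by simp
  qed
  show ?thesis using w
  proof (induction w)
    case Nil
    have "\<bar>\<phi> [\<one>, \<one>]\<bar> \<le> C * 3 ^ k" using b[of \<one> \<one> 0] by (simp only: L_one one_closed) simp
    then show ?case by (simp only: lift_Nil) simp
  next
    case (Cons x w)
    obtain s e where x: "x = (s, e)" by fastforce
    have s: "s \<in> S" "gen s \<in> carrier G" and w: "w \<in> words S" "eval_word G gen w \<in> carrier G"
      using Cons.prems gen_closed x by auto
    let ?n = "length w" and ?B = "C * (4 + of_nat (length w)) ^ k"
    have Lw: "L (eval_word G gen w) \<le> ?n" using w std_length_eval_le by blast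
    have B: "C * (3 + of_nat (Suc ?n)) ^ k = ?B" by simp
    have "\<bar>\<phi> [\<one>, \<one>]\<bar> \<le> ?B" "\<bar>\<phi> [inv (gen s), gen s]\<bar> \<le> ?B"
      "\<bar>\<phi> [gen s, eval_word G gen w]\<bar> \<le> ?B" "\<bar>\<phi> [inv (gen s), eval_word G gen w]\<bar> \<le> ?B"
      unfolding B[symmetric] using s w Lw L_letter_le[OF s(1)] L_one
      by - ((rule b; simp)+)
    then have "\<bar>lift G gen \<phi> (x # w)\<bar> \<le> \<bar>lift G gen \<phi> w\<bar> + 3 * ?B"
      unfolding x lift_Cons[OF s(1) w(1)] by (auto simp del: cocycle_one_left cocycle_one_right)
    also have "\<bar>lift G gen \<phi> w\<bar> \<le> C * (1 + 3 * of_nat ?n) * (3 + of_nat ?n) ^ k"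
      using Cons.IH w by blast
    also have "\<dots> \<le> C * (1 + 3 * of_nat ?n) * (4 + of_nat ?n) ^ k"
      using C by (intro mult_left_mono power_mono) auto
    finally show ?case by (simp add: algebra_simps)
  qed
qed

text \<open>Geodesic words have length \<open>L g\<close>, so \<open>lift_bound\<close> applies; the
  number of letters raises the degree by one.\<close>

lemma section_cochain_poly_growth:
  assumes "cob G 2 \<phi> = (\<lambda>_. 0)" "poly_growth G L \<phi>"
  shows "poly_growth G L (section_cochain \<phi>)"
proof -
  obtain C k where C: "C \<ge> 0" and \<phi>:
    "\<And>gs. gs \<in> lists (carrier G) \<Longrightarrow> \<bar>\<phi> gs\<bar> \<le> C * (1 + of_nat (sum_list (map L gs))) ^ k"
    using poly_growthE[OF assms(2)] by metis
  show ?thesis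
  proof (rule poly_growth_1I[OF section_cochain_in_cochains])
    show "0 \<le> C * 3 * 3 ^ k" using C by simp
    fix g assume g: "g \<in> carrier G"
    let ?n = "of_nat (L g) :: rat"
    have "\<bar>section_cochain \<phi> [g]\<bar> \<le> C * (1 + 3 * ?n) * (3 + ?n) ^ k"
      using lift_bound[OF assms(1) C \<phi> nf(1)[OF g]] nf(2)[OF g] g by (simp add: section_cochain_def)
    also have "\<dots> \<le> C * (3 * (1 + ?n)) * (3 * (1 + ?n)) ^ k"
      using C by (intro mult_mono power_mono mult_left_mono) auto
    also have "\<dots> = C * 3 * 3 ^ k * (1 + ?n) ^ Suc k" by (simp only: power_mult_distrib power_Suc mult_ac)
    finally show "\<bar>section_cochain \<phi> [g]\<bar> \<le> C * 3 * 3 ^ k * (1 + ?n) ^ Suc k" .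
  qed
qed

text \<open>If all relator values are 0, so are those of the defect words, and \<open>\<phi>\<close>
  is minus the coboundary of \<open>section_cochain \<phi>\<close>. That cochain inherits polynomial
  growth from \<open>\<phi>\<close>.\<close>

lemma pcoboundary_if_fibres_vanish:
  assumes "\<phi> \<in> pcocycles G L 2" "\<And>r. r \<in> W \<Longrightarrow> fibre G gen \<phi> r = 0"
  shows "\<phi> \<in> pcoboundaries G L 2"
proof -
  have \<phi>: "\<phi> \<in> cochains G 2" "poly_growth G L \<phi>" "cob G 2 \<phi> = (\<lambda>_. 0)"
    using assms(1) by (auto simp: pcocycles_def pcochains_def)
  interpret two_cocycle G \<phi> gen S by (rule two_cocycleI) (fact \<phi>(3))
  let ?\<psi> = "\<lambda>x. - 1 * section_cochain \<phi> x"
  have "\<phi> = cob G 1 ?\<psi>"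
  proof (rule cochains_2_eqI[OF \<phi>(1)])
    show "cob G 1 ?\<psi> \<in> cochains G 2" using cob_in_cochains[of G 1] by (simp add: numeral_2_eq_2)
    fix g h assume gh: "g \<in> carrier G" "h \<in> carrier G"
    note u = defect_word[OF gh]
    obtain cs where cs: "conj_decomp S W (nf g @ nf h @ inv_word (nf (g \<otimes> h))) cs"
      using decomp_length_le_dehn[OF u] by blast
    \<comment> \<open>The bound on relator values is taken to be 0, so any decomposition of the
      defect word will do.\<close>
    have "\<bar>fibre G gen \<phi> (nf g @ nf h @ inv_word (nf (g \<otimes> h)))\<bar> \<le> of_nat (length cs) * 0"
      by (rule fibre_conj_decomp_bound[OF cs u(1) W_words relator_eval]) (use assms(2) in auto)
    then have "\<phi> [g, h] + cob G 1 (section_cochain \<phi>) [g, h] = 0"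
      using cocycle_plus_cob_section[OF \<phi>(3) gh] by simp
    then show "\<phi> [g, h] = cob G 1 ?\<psi> [g, h]"
      unfolding cob_scale by simp
  qed
  moreover have "?\<psi> \<in> pcochains G L 1"
    using cochains_scale[OF section_cochain_in_cochains, of "-1"]
      poly_growth_scale[OF section_cochain_poly_growth[OF \<phi>(3,2)], of "-1"]
    unfolding pcochains_def by simp
  ultimately show ?thesis unfolding pcoboundaries_2 by blast
qed

end

section \<open>Functionals represented by chains\<close>

text \<open>Agreement is demanded on cocycles because only there is the extension known to be a
  group and its words evaluated by \<open>lift_Cons\<close>. The chain must not depend on the
  cocycle.\<close>

definition chain_functional :: "('g, 'b) monoid_scheme \<Rightarrow> (('g list \<Rightarrow> rat) \<Rightarrow> rat) \<Rightarrow> bool" where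
  "chain_functional G T \<longleftrightarrow> (\<exists>c\<in>chains G 2. \<forall>\<phi>. cob G 2 \<phi> = (\<lambda>_. 0) \<longrightarrow> T \<phi> = pairing \<phi> c)"

lemma chain_functional_cong:
  assumes "chain_functional G T" "\<And>\<phi>. cob G 2 \<phi> = (\<lambda>_. 0) \<Longrightarrow> T' \<phi> = T \<phi>"
  shows "chain_functional G T'"
  using assms unfolding chain_functional_def by fastforce

lemma chain_functional_add:
  assumes "chain_functional G T" "chain_functional G T'"
  shows "chain_functional G (\<lambda>\<phi>. T \<phi> + T' \<phi>)"
proof -
  obtain c c' where c: "c \<in> chains G 2" "c' \<in> chains G 2"
    and T: "\<And>\<phi>. cob G 2 \<phi> = (\<lambda>_. 0) \<Longrightarrow> T \<phi> = pairing \<phi> c"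
    "\<And>\<phi>. cob G 2 \<phi> = (\<lambda>_. 0) \<Longrightarrow> T' \<phi> = pairing \<phi> c'"
    using assms unfolding chain_functional_def by auto
  show ?thesis unfolding chain_functional_def
    by (rule bexI[OF _ chains_add[OF c]]) (simp add: T pairing_add_right[OF c])
qed

lemma chain_functional_scale:
  assumes "chain_functional G T"
  shows "chain_functional G (\<lambda>\<phi>. a * T \<phi>)"
proof -
  obtain c where c: "c \<in> chains G 2"
    and T: "\<And>\<phi>. cob G 2 \<phi> = (\<lambda>_. 0) \<Longrightarrow> T \<phi> = pairing \<phi> c"
    using assms unfolding chain_functional_def by auto
  show ?thesis unfolding chain_functional_def
    by (rule bexI[OF _ chains_scale[OF c, of a]]) (simp add: T pairing_scale_right[OF c])
qed

lemma chain_functional_diff: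
  assumes "chain_functional G T" "chain_functional G T'"
  shows "chain_functional G (\<lambda>\<phi>. T \<phi> - T' \<phi>)"
  using chain_functional_add[OF assms(1) chain_functional_scale[OF assms(2), of "-1"]] by simp

lemma chain_functional_eval:
  assumes "g \<in> carrier G" "h \<in> carrier G"
  shows "chain_functional G (\<lambda>\<phi>. \<phi> [g, h])"
  unfolding chain_functional_def
  by (rule bexI[OF _ chains_single[of "[g, h]"]]) (use assms in \<open>simp_all add: pairing_single\<close>)

lemma chain_functional_sum:
  assumes "finite I" "\<And>i. i \<in> I \<Longrightarrow> chain_functional G (T i)"
  shows "chain_functional G (\<lambda>\<phi>. \<Sum>i\<in>I. T i \<phi>)"
  using assms
proof (induction I rule: finite_induct)
  case empty
  show ?case unfolding chain_functional_def
    by (rule bexI[OF _ chains_zero]) (simp add: pairing_def)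
next
  case (insert i I)
  then show ?case using chain_functional_add[of G "T i"] by simp
qed

text \<open>In the recursion \<open>lift_Cons\<close> the arguments of \<open>\<phi>\<close> depend
  on the word alone, so every letter adds pairings with fixed point masses.\<close>

lemma (in fin_pres) chain_functional_lift:
  "w \<in> words S \<Longrightarrow> chain_functional G (\<lambda>\<phi>. lift G gen \<phi> w)"
proof (induction w)
  case Nil
  have "chain_functional G (\<lambda>\<phi>. - 1 * \<phi> [\<one>, \<one>])"
    by (intro chain_functional_scale chain_functional_eval one_closed)
  then show ?case
    by (rule chain_functional_cong) (simp add: two_cocycle.lift_Nil[OF two_cocycleI])
next
  case (Cons x w)
  obtain s b where x: "x = (s, b)" by fastforce
  have s: "s \<in> S" "gen s \<in> carrier G" and w: "w \<in> words S" "eval_word G gen w \<in> carrier G"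
    using Cons.prems gen_closed x by auto
  note IH = Cons.IH[OF w(1)]
  have "chain_functional G (\<lambda>\<phi>. lift G gen \<phi> w + \<phi> [gen s, eval_word G gen w])"
    by (intro chain_functional_add chain_functional_eval IH s w)
  moreover have "chain_functional G (\<lambda>\<phi>. lift G gen \<phi> w + \<phi> [inv (gen s), eval_word G gen w]
      - \<phi> [\<one>, \<one>] - \<phi> [inv (gen s), gen s])"
    by (intro chain_functional_diff chain_functional_add chain_functional_eval IH s w one_closed inv_closed)
  ultimately have "chain_functional G (\<lambda>\<phi>. if b then lift G gen \<phi> w + \<phi> [gen s, eval_word G gen w]
      else lift G gen \<phi> w + \<phi> [inv (gen s), eval_word G gen w] - \<phi> [\<one>, \<one>] - \<phi> [inv (gen s), gen s])"
    by (cases b) simp_all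
  then show ?case
    unfolding x by (rule chain_functional_cong) (rule two_cocycle.lift_Cons[OF two_cocycleI s(1) w(1)])
qed

lemma (in fin_pres) chain_functional_fibre:
  "w \<in> words S \<Longrightarrow> chain_functional G (\<lambda>\<phi>. fibre G gen \<phi> w)"
  unfolding fibre_def by (intro chain_functional_add chain_functional_lift chain_functional_eval one_closed)

section \<open>Boundaries and homology classes\<close>

lemma (in group) face_closed:
  assumes "x \<in> lists (carrier G)" "length x = Suc n" "i \<le> Suc n"
  shows "face G x i \<in> lists (carrier G) \<and> length (face G x i) = n"
proof -
  have x: "set x \<subseteq> carrier G" using assms(1) by auto
  consider "i = 0" | "i = Suc n" | "0 < i" "i \<le> n" using assms(3) by linarith
  then show ?thesis
  proof cases
    case 1
    then show ?thesis using x assms(2) by (cases x) (auto simp: face_def)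
  next
    case 2
    then show ?thesis using x assms(2) by (auto simp: face_def dest: in_set_butlastD)
  next
    case 3
    then have "x ! (i - 1) \<in> carrier G" "x ! i \<in> carrier G" using x assms(2) by auto
    then show ?thesis
      using 3 x assms(2) set_take_subset[of "i - 1" x] set_drop_subset[of "i + 1" x] by (auto simp: face_def)
  qed
qed

lemma (in group) bd_in_chains:
  assumes "c \<in> chains G (Suc n)"
  shows "bd G c \<in> chains G n"
proof -
  have "finite {y. bd G c y \<noteq> 0}"
    by (rule finite_subset[OF bd_support]) (use chainsD(1)[OF assms] in blast)
  moreover have "y \<in> lists (carrier G) \<and> length y = n" if y: "bd G c y \<noteq> 0" for y
  proof -
    obtain x i where "c x \<noteq> 0" "i \<le> length x" "face G x i = y"
      using bd_outside[of c G y] y by blast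
    then show ?thesis using face_closed chainsD(2,3)[OF assms] by metis
  qed
  ultimately show ?thesis by (simp add: chains_def)
qed

lemma functional_eq_sum:
  fixes F :: "('x \<Rightarrow> rat) \<Rightarrow> rat"
  assumes "finite A" "\<And>x. c x \<noteq> 0 \<Longrightarrow> x \<in> A"
    and add: "\<And>u v. F (\<lambda>x. u x + v x) = F u + F v" and scale: "\<And>a u. F (\<lambda>x. a * u x) = a * F u"
  shows "F c = (\<Sum>x\<in>A. c x * F (\<lambda>y. if y = x then 1 else 0))"
  using assms(1,2)
proof (induction A arbitrary: c rule: finite_induct)
  case empty
  \<comment> \<open>Here \<open>c\<close> is the zero function, and homogeneity with factor 0 gives
    \<open>F c = 0\<close>.\<close>
  then have "c = (\<lambda>x. 0 * c x)" by auto
  then have "F c = 0 * F c" by (metis scale)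
  then show ?case by simp
next
  case (insert x A)
  let ?d = "\<lambda>y. if y = x then 0 else c y"
  have "c = (\<lambda>y. ?d y + c x * (if y = x then 1 else 0))" by auto
  then have "F c = F (\<lambda>y. ?d y + c x * (if y = x then 1 else 0))" by (rule arg_cong)
  also have "\<dots> = F ?d + c x * F (\<lambda>y. if y = x then 1 else 0)" by (simp only: add scale)
  also have "F ?d = (\<Sum>z\<in>A. ?d z * F (\<lambda>y. if y = z then 1 else 0))"
    by (rule insert.IH) (use insert.prems in \<open>auto split: if_splits\<close>)
  also have "\<dots> = (\<Sum>z\<in>A. c z * F (\<lambda>y. if y = z then 1 else 0))"
    by (rule sum.cong) (use insert.hyps in auto)
  finally show ?case using insert.hyps by simp
qed

definition homologous :: "('g, 'b) monoid_scheme \<Rightarrow> nat \<Rightarrow> (('g list \<Rightarrow> rat) \<times> ('g list \<Rightarrow> rat)) set" where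
  "homologous G n = {(c, d). c \<in> cycles G n \<and> d \<in> cycles G n \<and> (\<lambda>x. c x - d x) \<in> boundaries G n}"

lemma homology_eq: "homology G n = cycles G n // homologous G n"
  by (simp add: homology_def homologous_def)

lemma equiv_homologous: "equiv (cycles G n) (homologous G n)"
proof (rule equivI)
  show "homologous G n \<subseteq> cycles G n \<times> cycles G n" by (auto simp: homologous_def)
  show "refl_on (cycles G n) (homologous G n)"
    by (auto simp: refl_on_def homologous_def boundaries_zero)
  show "sym (homologous G n)"
  proof (rule symI)
    fix c d assume "(c, d) \<in> homologous G n"
    then show "(d, c) \<in> homologous G n"
      using boundaries_scale[of "\<lambda>x. c x - d x" G n "-1"] by (simp add: homologous_def)
  qed
  show "trans (homologous G n)"
  proof (rule transI)
    fix c d e assume "(c, d) \<in> homologous G n" "(d, e) \<in> homologous G n"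
    then show "(c, e) \<in> homologous G n"
      using boundaries_add[of "\<lambda>x. c x - d x" G n "\<lambda>x. d x - e x"] by (simp add: homologous_def)
  qed
qed

lemma pairing_boundary:
  assumes "cob G n \<phi> = (\<lambda>_. 0)" "b \<in> boundaries G n"
  shows "pairing \<phi> b = 0"
proof -
  obtain c where "c \<in> chains G (Suc n)" "b = bd G c" using assms(2) by (auto simp: boundaries_def)
  then show ?thesis using pairing_bd[of c G n \<phi>] assms(1) by (simp add: pairing_def)
qed

lemma pairing_cob_cycle: "c \<in> cycles G (Suc n) \<Longrightarrow> pairing (cob G n \<psi>) c = 0"
  using pairing_bd[of c G n \<psi>] by (simp add: cycles_def pairing_def)

text \<open>The representative picked by \<open>SOME\<close> in \<open>alpha\<close> differs from
  \<open>c\<close> by a boundary, and cocycles pair to 0 with boundaries.\<close>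

lemma alpha_class:
  assumes "c \<in> cycles G n" "\<phi> \<in> pcocycles G L n"
  shows "alpha G L n (homologous G n `` {c}) \<phi> = pairing \<phi> c"
proof -
  let ?d = "SOME d. d \<in> homologous G n `` {c}"
  have "c \<in> homologous G n `` {c}" using equiv_class_self[OF equiv_homologous assms(1)] .
  then have "?d \<in> homologous G n `` {c}" by (rule someI[of "\<lambda>d. d \<in> homologous G n `` {c}"])
  then have d: "?d \<in> cycles G n" "(\<lambda>x. c x - ?d x) \<in> boundaries G n"
    by (auto simp: homologous_def)
  have "cob G n \<phi> = (\<lambda>_. 0)" using assms(2) by (simp add: pcocycles_def)
  then have "pairing \<phi> c - pairing \<phi> ?d = 0"
    using pairing_boundary[OF _ d(2)] pairing_diff_right[of c G n ?d \<phi>] d(1) assms(1)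
    by (simp add: cycles_def)
  then show ?thesis using assms(2) by (simp add: alpha_def)
qed

section \<open>Well-definedness, injectivity and surjectivity of the map into the dual\<close>

context fin_pres
begin

lemma pcoboundaries_subset_pcocycles: "pcoboundaries G L 2 \<subseteq> pcocycles G L 2"
proof
  fix \<phi> assume "\<phi> \<in> pcoboundaries G L 2"
  then obtain \<psi> where \<psi>: "\<psi> \<in> pcochains G L 1" "\<phi> = cob G 1 \<psi>" by (auto simp: pcoboundaries_2)
  then have "poly_growth G L \<phi>" using poly_growth_cob_1[OF _ L_mult_le] by (simp add: pcochains_def)
  moreover have "\<phi> \<in> cochains G 2" using cob_in_cochains[of G 1 \<psi>] \<psi>(2) by (simp add: numeral_2_eq_2)
  moreover have "cob G 2 \<phi> = (\<lambda>_. 0)" unfolding \<psi>(2) by (rule cob_cob_1)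
  ultimately show "\<phi> \<in> pcocycles G L 2" by (simp add: pcocycles_def pcochains_def)
qed

lemma alpha_class_in_dual:
  assumes "c \<in> cycles G 2"
  shows "alpha G L 2 (homologous G 2 `` {c}) \<in> pcohomology_dual G L 2"
proof -
  let ?\<Lambda> = "alpha G L 2 (homologous G 2 `` {c})"
  have "?\<Lambda> \<phi> = 0" if \<phi>: "\<phi> \<in> pcoboundaries G L 2" for \<phi>
  proof -
    obtain \<psi> where \<psi>: "\<phi> = cob G 1 \<psi>" using \<phi> by (auto simp: pcoboundaries_2)
    have "pairing \<phi> c = 0"
      unfolding \<psi> by (rule pairing_cob_cycle) (use assms in \<open>simp add: numeral_2_eq_2\<close>)
    then show ?thesis using alpha_class[OF assms] \<phi> pcoboundaries_subset_pcocycles by auto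
  qed
  moreover have "?\<Lambda> \<phi> = 0" if "\<phi> \<notin> pcocycles G L 2" for \<phi>
    using that by (simp add: alpha_def)
  ultimately show ?thesis
    unfolding pcohomology_dual_def
    by (simp add: alpha_class[OF assms] pcocycles_add pcocycles_scale pairing_add_left pairing_scale_left)
qed

text \<open>A functional separating \<open>c\<close> from the boundaries is pairing with some
  cocycle. A p-bounded cocycle cohomologous to it has the same pairing with the cycle
  \<open>c\<close>, namely 1, against the assumption.\<close>

lemma boundary_if_pairings_vanish:
  assumes "polynomial_dehn S W" "c \<in> cycles G 2"
    and zero: "\<And>\<phi>. \<phi> \<in> pcocycles G L 2 \<Longrightarrow> pairing \<phi> c = 0"
  shows "c \<in> boundaries G 2"
proof (rule ccontr)
  assume notin: "c \<notin> boundaries G 2"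
  obtain F :: "('g list \<Rightarrow> rat) \<Rightarrow> rat" where F:
    "(\<forall>u v. F (\<lambda>x. u x + v x) = F u + F v) \<and> (\<forall>a u. F (\<lambda>x. a * u x) = a * F u) \<and>
     (\<forall>u\<in>boundaries G 2. F u = 0) \<and> F c = 1"
    using separating_functional[OF boundaries_zero boundaries_add boundaries_scale notin] by (rule exE)
  note add = F[THEN conjunct1, rule_format]
    and scale = F[THEN conjunct2, THEN conjunct1, rule_format]
    and F0 = F[THEN conjunct2, THEN conjunct2, THEN conjunct1, rule_format]
    and Fc = F[THEN conjunct2, THEN conjunct2, THEN conjunct2]
  \<comment> \<open>The values of \<open>F\<close> on point masses determine it on chains, which
    have finite support; the default 0 keeps \<open>\<phi>\<close> in degree 2.\<close>
  define \<phi> where "\<phi> x = (if x \<in> lists (carrier G) \<and> length x = 2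
    then F (\<lambda>y. if y = x then 1 else 0) else 0)" for x
  have coch: "\<phi> \<in> cochains G 2" by (simp add: cochains_def \<phi>_def)
  have F_eq: "F d = pairing \<phi> d" if d: "d \<in> chains G 2" for d
  proof -
    have "F d = (\<Sum>x\<in>{x. d x \<noteq> 0}. d x * F (\<lambda>y. if y = x then 1 else 0))"
      by (rule functional_eq_sum[OF chainsD(1)[OF d] _ add scale]) simp
    also have "\<dots> = pairing \<phi> d"
      unfolding pairing_def by (rule sum.cong) (use chainsD(2,3)[OF d] in \<open>auto simp: \<phi>_def\<close>)
    finally show ?thesis .
  qed
  have cob: "cob G 2 \<phi> = (\<lambda>_. 0)"
  proof
    fix x
    show "cob G 2 \<phi> x = 0"
    proof (cases "x \<in> lists (carrier G) \<and> length x = Suc 2")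
      case True
      let ?s = "\<lambda>y. if y = x then 1 else 0 :: rat"
      have s: "?s \<in> chains G (Suc 2)" using True by (intro chains_single) auto
      \<comment> \<open>By adjointness the coboundary at \<open>x\<close> is the value of
        \<open>F\<close> on the boundary of the point mass at \<open>x\<close>, which is 0.\<close>
      have "cob G 2 \<phi> x = pairing \<phi> (bd G ?s)"
        using pairing_bd[OF s, of \<phi>] by (simp only: pairing_single)
      also have "\<dots> = F (bd G ?s)" using F_eq[OF bd_in_chains[OF s]] by simp
      also have "\<dots> = 0" by (rule F0) (unfold boundaries_def, rule imageI[OF s])
      finally show ?thesis .
    next
      case False
      then show ?thesis unfolding cob_def[of G 2] by (simp only: if_not_P if_False)
    qed
  qed
  have c: "c \<in> chains G 2" "c \<in> cycles G (Suc 1)"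
    using assms(2) by (auto simp: cycles_def numeral_2_eq_2)
  \<comment> \<open>The polynomial Dehn function enters here, through the p-bounded replacement of
    \<open>\<phi>\<close>.\<close>
  have "pairing (\<lambda>x. \<phi> x + cob G 1 (section_cochain \<phi>) x) c = 0"
    by (rule zero[OF cocycle_cohomologous_poly_growth[OF assms(1) coch cob]])
  then have "pairing \<phi> c = 0"
    unfolding pairing_add_left pairing_cob_cycle[OF c(2)] by simp
  then show False using F_eq[OF c(1)] Fc by simp
qed

text \<open>A p-bounded cocycle with vanishing relator values is a p-bounded coboundary, hence
  killed by \<open>\<Lambda>\<close>. So \<open>\<Lambda>\<close> is a combination of the finitely
  many relator values, each of which is pairing with a chain.\<close>

lemma dual_represented_by_cycle:
  assumes "\<Lambda> \<in> pcohomology_dual G L 2"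
  obtains c where "c \<in> cycles G 2" "\<And>\<phi>. \<phi> \<in> pcocycles G L 2 \<Longrightarrow> \<Lambda> \<phi> = pairing \<phi> c"
proof -
  have add: "\<And>\<phi> \<psi>. \<phi> \<in> pcocycles G L 2 \<Longrightarrow> \<psi> \<in> pcocycles G L 2 \<Longrightarrow> \<Lambda> (\<lambda>x. \<phi> x + \<psi> x) = \<Lambda> \<phi> + \<Lambda> \<psi>"
    and scale: "\<And>a \<phi>. \<phi> \<in> pcocycles G L 2 \<Longrightarrow> \<Lambda> (\<lambda>x. a * \<phi> x) = a * \<Lambda> \<phi>"
    and zero: "\<And>\<phi>. \<phi> \<in> pcoboundaries G L 2 \<Longrightarrow> \<Lambda> \<phi> = 0"
    using assms unfolding pcohomology_dual_def by auto
  have cob: "cob G 2 \<phi> = (\<lambda>_. 0)" if "\<phi> \<in> pcocycles G L 2" for \<phi>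
    using that by (simp add: pcocycles_def)
  have cf: "chain_functional G (\<lambda>\<phi>. fibre G gen \<phi> r)" if "r \<in> W" for r
    using chain_functional_fibre that W_words by blast
  \<comment> \<open>Linearity in the cocycle is read off from the representing chain, as the
    extension itself changes with the cocycle.\<close>
  have fadd: "fibre G gen (\<lambda>x. \<phi> x + \<psi> x) r = fibre G gen \<phi> r + fibre G gen \<psi> r"
    if "r \<in> W" "\<phi> \<in> pcocycles G L 2" "\<psi> \<in> pcocycles G L 2" for r \<phi> \<psi>
    using cf[OF that(1)] cob[OF that(2)] cob[OF that(3)] cob[OF pcocycles_add[OF that(2,3)]]
    unfolding chain_functional_def by (auto simp: pairing_add_left)
  have fscale: "fibre G gen (\<lambda>x. a * \<phi> x) r = a * fibre G gen \<phi> r"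
    if "r \<in> W" "\<phi> \<in> pcocycles G L 2" for r a \<phi>
    using cf[OF that(1)] cob[OF that(2)] cob[OF pcocycles_scale[OF that(2)]]
    unfolding chain_functional_def by (auto simp: pairing_scale_left)
  have "\<exists>l. \<forall>\<phi>\<in>pcocycles G L 2. \<Lambda> \<phi> = (\<Sum>r\<in>W. l r * fibre G gen \<phi> r)"
    by (rule functional_combination[OF fin_W pcocycles_add pcocycles_scale add scale fadd fscale])
      (auto intro: zero pcoboundary_if_fibres_vanish)
  then obtain l where l: "\<And>\<phi>. \<phi> \<in> pcocycles G L 2 \<Longrightarrow> \<Lambda> \<phi> = (\<Sum>r\<in>W. l r * fibre G gen \<phi> r)"
    by blast
  have "chain_functional G (\<lambda>\<phi>. \<Sum>r\<in>W. l r * fibre G gen \<phi> r)"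
    by (intro chain_functional_sum fin_W chain_functional_scale cf)
  then obtain c where c: "c \<in> chains G 2"
    and \<Lambda>c: "\<And>\<phi>. \<phi> \<in> pcocycles G L 2 \<Longrightarrow> \<Lambda> \<phi> = pairing \<phi> c"
    unfolding chain_functional_def using l cob by auto
  have c': "c \<in> chains G (Suc 1)" using c by (simp add: numeral_2_eq_2)
  note bdc = bd_in_chains[OF c']
  txt \<open>Point masses are p-bounded 1-cochains, so vanishing on their coboundaries forces a cycle.\<close>
  have "bd G c y = 0" for y
  proof (rule ccontr)
    assume y: "bd G c y \<noteq> 0"
    let ?s = "\<lambda>x. if x = y then 1 else 0 :: rat"
    have "?s \<in> cochains G 1" using chainsD(2,3)[OF bdc y] by (simp add: cochains_def)
    then have "cob G 1 ?s \<in> pcoboundaries G L 2"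
      unfolding pcoboundaries_2 pcochains_def using poly_growth_single by blast
    then have "pairing (cob G 1 ?s) c = 0"
      using zero \<Lambda>c pcoboundaries_subset_pcocycles by (metis subsetD)
    then have "pairing ?s (bd G c) = 0" by (simp only: pairing_bd[OF c'])
    moreover have "pairing ?s (bd G c) = bd G c y"
      using y chainsD(1)[OF bdc] by (simp add: pairing_def if_distrib cong: if_cong)
    ultimately show False using y by simp
  qed
  then have "c \<in> cycles G 2" using c by (auto simp: cycles_def)
  with \<Lambda>c that show thesis by blast
qed

end

theorem theorem2p1p3:
  fixes G :: "('g, 'b) monoid_scheme" and gen :: "'a \<Rightarrow> 'g"
    and S :: "'a set" and W :: "'a word set"
  assumes "finite_presentation G gen S W"
    and "polynomial_dehn S W"
  shows "bij_betw (alpha G (std_length G gen S) 2) (homology G 2)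
           (pcohomology_dual G (std_length G gen S) 2)"
proof -
  interpret group G using assms(1) by (simp add: finite_presentation_def)
  interpret fin_pres G gen S W by unfold_locales (fact assms(1))
  show ?thesis
  proof (rule bij_betw_imageI)
    show "inj_on (alpha G L 2) (homology G 2)"
    proof (rule inj_onI)
      fix X Y assume "X \<in> homology G 2" "Y \<in> homology G 2" and eq: "alpha G L 2 X = alpha G L 2 Y"
      then obtain c d where cd: "c \<in> cycles G 2" "d \<in> cycles G 2"
        and X: "X = homologous G 2 `` {c}" and Y: "Y = homologous G 2 `` {d}"
        unfolding homology_eq by (auto elim!: quotientE)
      have ch: "c \<in> chains G 2" "d \<in> chains G 2" using cd by (auto simp: cycles_def)
      have "(\<lambda>x. c x - d x) \<in> boundaries G 2"
      proof (rule boundary_if_pairings_vanish[OF assms(2)])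
        \<comment> \<open>The difference is written as a sum with a multiple to match
          \<open>bd_add\<close> and \<open>bd_scale\<close>.\<close>
        have "bd G (\<lambda>x. c x + -1 * d x) = (\<lambda>_. 0)"
          using cd by (simp only: bd_add[OF ch(1) chains_scale[OF ch(2)]] bd_scale[OF ch(2)])
            (simp add: cycles_def)
        then show "(\<lambda>x. c x - d x) \<in> cycles G 2"
          using chains_diff[OF ch] by (simp add: cycles_def)
        show "pairing \<phi> (\<lambda>x. c x - d x) = 0" if "\<phi> \<in> pcocycles G L 2" for \<phi>
          using alpha_class[OF cd(1) that] alpha_class[OF cd(2) that] eq
          by (simp add: X Y pairing_diff_right[OF ch])
      qed
      then have "(c, d) \<in> homologous G 2" using cd by (simp add: homologous_def)
      then show "X = Y" unfolding X Y by (rule equiv_class_eq[OF equiv_homologous])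
    qed
    show "alpha G L 2 ` homology G 2 = pcohomology_dual G L 2"
    proof (intro equalityI subsetI)
      fix \<Lambda> assume "\<Lambda> \<in> alpha G L 2 ` homology G 2"
      then show "\<Lambda> \<in> pcohomology_dual G L 2"
        unfolding homology_eq using alpha_class_in_dual by (auto elim!: quotientE)
    next
      fix \<Lambda> assume \<Lambda>: "\<Lambda> \<in> pcohomology_dual G L 2"
      obtain c where c: "c \<in> cycles G 2" "\<And>\<phi>. \<phi> \<in> pcocycles G L 2 \<Longrightarrow> \<Lambda> \<phi> = pairing \<phi> c"
        using dual_represented_by_cycle[OF \<Lambda>] by blast
      \<comment> \<open>Equality is needed as functions on all cochains; off the p-bounded cocycles
        both sides are 0 by convention.\<close>
      have "\<Lambda> \<phi> = alpha G L 2 (homologous G 2 `` {c}) \<phi>" for \<phi>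
      proof (cases "\<phi> \<in> pcocycles G L 2")
        case True
        then show ?thesis using alpha_class[OF c(1) True] c(2) by simp
      next
        case False
        then show ?thesis using \<Lambda> by (simp add: pcohomology_dual_def alpha_def)
      qed
      then have "\<Lambda> = alpha G L 2 (homologous G 2 `` {c})" by blast
      then show "\<Lambda> \<in> alpha G L 2 ` homology G 2"
        unfolding homology_eq using quotientI[OF c(1)] by blast
    qed
  qed
qed

end
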